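(* Let $1 < q \le 2$ and $p = q/(q-1)$. Let $\{t_n\}_{n=1}^\infty$ be a weakness sequence, $\{\delta_n\}_{n=0}^\infty$ a perturbation sequence, and $\{\eta_n\}_{n=1}^\infty$ a bounded error sequence. Then the AWCGA with these sequences converges for every Banach space $X \in \mathcal{P}_q$, every dictionary $\mathcal{D}$ in $X$, and every element $f \in X$ if and only if there exists a subsequence $\{n_k\}_{k=1}^\infty$ (a strictly increasing sequence of positive integers) such that $$\sum_{k=1}^\infty t_{n_k+1}^p = \infty, \qquad \delta_{n_k} = o(t_{n_k+1}^p), \qquad \eta_{n_k} = o(t_{n_k+1}^p) \quad (k\to\infty).$$
   Context: Banach spaces are real. The modulus of smoothness of $X$ is $\rho(u) = \sup_{\|x\|=\|y\|=1} \frac{\|x+uy\|+\|x-uy\|}{2} - 1$. For $1<q\le 2$, $\mathcal{P}_q$ is the class of all Banach spaces whose modulus of smoothness satisfies $\rho(u) \le \gamma u^q$ (for all $u \geq 0$) for some $\gamma>0$. A dictionary in $X$ is a set $\mathcal{D}\subset X$ with $\|g\|=1$ for all $g\in\mathcal{D}$ and $\overline{\mathrm{span}}\,\mathcal{D}=X$; dictionaries are assumed symmetric ($g\in\mathcal{D}$ implies $-g\in\mathcal{D}$). A weakness sequence $\{t_n\}_{n\ge1}$ has $0\le t_n\le1$; a perturbation sequence $\{\delta_n\}_{n\ge0}$ has $0\le\delta_n\le1$; an error sequence $\{\eta_n\}_{n\ge1}$ has $\eta_n\ge0$. Approximate Weak Chebyshev Greedy Algorithm (AWCGA) of $f\in X$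 with these sequences: set $f_0=f$, and for $n\ge1$: (1) take any bounded linear functional $F_{n-1}$ on $X$ with $\|F_{n-1}\|\le1$ and $F_{n-1}(f_{n-1})\ge(1-\delta_{n-1})\|f_{n-1}\|$, and any $\phi_n\in\mathcal{D}$ with $F_{n-1}(\phi_n)\ge t_n\sup_{g\in\mathcal{D}}F_{n-1}(g)$; (2) let $\Phi_n=\mathrm{span}\{\phi_1,\dots,\phi_n\}$, $E_n=\inf_{G\in\Phi_n}\|f-G\|$, and take any $G_n\in\Phi_n$ with $\|f-G_n\|\le(1+\eta_n)E_n$; (3) set $f_n=f-G_n$. Any sequence of admissible choices is a realization. The AWCGA of $f$ converges if $\|f_n\|\to0$ for every realization; it diverges (does not converge) if there is a realization with $\|f_n\|\not\to0$. For nonnegative sequences, $a_k=o(b_k)$ means that $a_k\le\epsilon_k b_k$ with $\epsilon_k\to0$. *)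

theory Defs
  imports "HOL-Analysis.Analysis" "HOL-Algebra.Module"
begin

text \<open>
  The theorem quantifies over all Banach spaces inside a formula, which the type class
  \<^class>\<open>banach\<close> cannot express.  A Banach space is therefore an explicit structure on an
  arbitrary carrier set: a \<^locale>\<open>module\<close> over the field of reals with a complete norm.  (The
  multiplicative fields \<^const>\<open>mult\<close> and \<^const>\<open>one\<close> that the module record inherits are unused.)

  The theorem is stated for an arbitrary type \<open>'a\<close> from which the points of the spaces are drawn.
  Its only requirement is an injection of real sequences into \<open>'a\<close>: over a type that is
  too small, for instance a finite one, the zero space is the only Banach space and convergence in
  all spaces holds vacuously.  A Banach space of any cardinality has an isometric copy over some
  such type.
\<close>

definition real_ring :: "real ring" where
  "real_ring = \<lparr>carrier = UNIV, mult = (*), one = 1, zero = 0, add = (+)\<rparr>"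

record 'a normed_struct = "(real, 'a) module" +
  nrm :: "'a \<Rightarrow> real"

text \<open>
  \<^locale>\<open>Metric_space\<close> asks for nonnegativity and symmetry outside the carrier too, hence the default
  value 0 there.
\<close>

definition ndist :: "'a normed_struct \<Rightarrow> 'a \<Rightarrow> 'a \<Rightarrow> real" where
  "ndist X x y = (if x \<in> carrier X \<and> y \<in> carrier X then nrm X (x \<ominus>\<^bsub>X\<^esub> y) else 0)"

definition real_normed_space :: "'a normed_struct \<Rightarrow> bool" where
  "real_normed_space X \<longleftrightarrow>
     Module.module real_ring X \<and>
     (\<forall>x\<in>carrier X. nrm X x = 0 \<longleftrightarrow> x = \<zero>\<^bsub>X\<^esub>) \<and>
     (\<forall>a. \<forall>x\<in>carrier X. nrm X (a \<odot>\<^bsub>X\<^esub> x) = \<bar>a\<bar> * nrm X x) \<and>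
     (\<forall>x\<in>carrier X. \<forall>y\<in>carrier X. nrm X (x \<oplus>\<^bsub>X\<^esub> y) \<le> nrm X x + nrm X y)"

definition banach_space :: "'a normed_struct \<Rightarrow> bool" where
  "banach_space X \<longleftrightarrow>
     real_normed_space X \<and> Metric_space.mcomplete (carrier X) (ndist X)"

definition lin_span :: "'a normed_struct \<Rightarrow> 'a set \<Rightarrow> 'a set" where
  "lin_span X S = (\<lambda>H. submodule H real_ring X) hull S"

definition linear_functional :: "'a normed_struct \<Rightarrow> ('a \<Rightarrow> real) \<Rightarrow> bool" where
  "linear_functional X F \<longleftrightarrow>
     (\<forall>x\<in>carrier X. \<forall>y\<in>carrier X. F (x \<oplus>\<^bsub>X\<^esub> y) = F x + F y) \<and>
     (\<forall>a. \<forall>x\<in>carrier X. F (a \<odot>\<^bsub>X\<^esub> x) = a * F x)"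

definition bounded_linear_functional :: "'a normed_struct \<Rightarrow> ('a \<Rightarrow> real) \<Rightarrow> bool" where
  "bounded_linear_functional X F \<longleftrightarrow>
     linear_functional X F \<and> (\<exists>K. \<forall>x\<in>carrier X. \<bar>F x\<bar> \<le> K * nrm X x)"

definition functional_norm :: "'a normed_struct \<Rightarrow> ('a \<Rightarrow> real) \<Rightarrow> real" where
  "functional_norm X F = (SUP x\<in>{x \<in> carrier X. nrm X x \<le> 1}. \<bar>F x\<bar>)"

lemma cring_real_ring: "cring real_ring"
  unfolding real_ring_def
  by (unfold_locales) (auto simp: Units_def algebra_simps intro: exI[of _ "- _"])

lemma Metric_space_ndist:
  assumes "real_normed_space X"
  shows "Metric_space (carrier X) (ndist X)"
proof -
  interpret module real_ring X using assms by (simp add: real_normed_space_def)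
  have z: "\<And>x. x \<in> carrier X \<Longrightarrow> nrm X x = 0 \<longleftrightarrow> x = \<zero>\<^bsub>X\<^esub>"
   and h: "\<And>a x. x \<in> carrier X \<Longrightarrow> nrm X (a \<odot>\<^bsub>X\<^esub> x) = \<bar>a\<bar> * nrm X x"
   and t: "\<And>x y. x \<in> carrier X \<Longrightarrow> y \<in> carrier X \<Longrightarrow> nrm X (x \<oplus>\<^bsub>X\<^esub> y) \<le> nrm X x + nrm X y"
    using assms by (auto simp: real_normed_space_def)
  have m1: "\<ominus>\<^bsub>X\<^esub> x = (-1) \<odot>\<^bsub>X\<^esub> x" if "x \<in> carrier X" for x
  proof -
    have "\<ominus>\<^bsub>real_ring\<^esub> \<one>\<^bsub>real_ring\<^esub> = -1"
      by (rule R.minus_equality) (auto simp: real_ring_def)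
    then show ?thesis
      using smult_l_minus[of "\<one>\<^bsub>real_ring\<^esub>" x] that by simp
  qed
  have neg: "nrm X (\<ominus>\<^bsub>X\<^esub> x) = nrm X x" if "x \<in> carrier X" for x
    using h[OF that, of "-1"] m1[OF that] by simp
  have nn: "0 \<le> nrm X x" if "x \<in> carrier X" for x
    using t[of x "\<ominus>\<^bsub>X\<^esub> x"] neg[OF that] z[of "\<zero>\<^bsub>X\<^esub>"] that by (simp add: M.r_neg)
  have com: "nrm X (x \<ominus>\<^bsub>X\<^esub> y) = nrm X (y \<ominus>\<^bsub>X\<^esub> x)" if "x \<in> carrier X" "y \<in> carrier X" for x y
    using neg[of "x \<ominus>\<^bsub>X\<^esub> y"] that by (simp add: a_minus_def M.minus_add M.a_comm)
  have tri: "nrm X (x \<ominus>\<^bsub>X\<^esub> w) \<le> nrm X (x \<ominus>\<^bsub>X\<^esub> y) + nrm X (y \<ominus>\<^bsub>X\<^esub> w)"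
    if "x \<in> carrier X" "y \<in> carrier X" "w \<in> carrier X" for x y w
  proof -
    have "x \<ominus>\<^bsub>X\<^esub> w = (x \<ominus>\<^bsub>X\<^esub> y) \<oplus>\<^bsub>X\<^esub> (y \<ominus>\<^bsub>X\<^esub> w)"
      using that by (simp add: a_minus_def M.a_assoc M.r_neg2 M.r_neg1)
    then show ?thesis using t[of "x \<ominus>\<^bsub>X\<^esub> y" "y \<ominus>\<^bsub>X\<^esub> w"] that by simp
  qed
  have eq: "x \<ominus>\<^bsub>X\<^esub> y = \<zero>\<^bsub>X\<^esub> \<longleftrightarrow> x = y" if "x \<in> carrier X" "y \<in> carrier X" for x y
    using that M.r_neg
    by (metis M.a_inv_closed M.l_neg M.minus_equality M.minus_minus a_minus_def)
  show ?thesis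
    by unfold_locales (auto simp: ndist_def nn com z tri eq)
qed

text \<open>Every type of class \<^class>\<open>banach\<close> is a Banach space in this sense, with the usual span.\<close>

definition class_struct :: "'a::banach normed_struct" where
 "class_struct = \<lparr>carrier = UNIV, mult = undefined, one = undefined, zero = 0, add = (+), smult = scaleR, nrm = norm\<rparr>"

lemma module_class_struct: "Module.module real_ring (class_struct :: 'a::banach normed_struct)"
proof (rule moduleI)
  show "abelian_group (class_struct :: 'a normed_struct)"
    by (rule abelian_groupI) (auto simp: class_struct_def algebra_simps intro: exI[of _ "- _"])
qed (auto simp: class_struct_def real_ring_def cring_real_ring[unfolded real_ring_def] algebra_simps)

lemma minus_class_struct: "(x::'a::banach) \<ominus>\<^bsub>class_struct\<^esub> y = x - y"
proof -
  interpret module real_ring "class_struct :: 'a normed_struct" by (rule module_class_struct)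
  have "\<ominus>\<^bsub>class_struct\<^esub> y = - y" by (rule M.minus_equality) (auto simp: class_struct_def)
  then show ?thesis by (simp add: a_minus_def class_struct_def)
qed

lemma banach_space_class_struct: "banach_space (class_struct :: 'a::banach normed_struct)"
proof -
  have d: "ndist (class_struct :: 'a normed_struct) = dist"
    by (auto simp: fun_eq_iff ndist_def minus_class_struct dist_norm) (auto simp: class_struct_def)
  have [simp]: "carrier (class_struct :: 'a normed_struct) = UNIV" by (simp add: class_struct_def)
  show ?thesis unfolding banach_space_def d using module_class_struct
    by (auto simp: real_normed_space_def) (auto simp: class_struct_def norm_triangle_ineq complete_UNIV)
qed

lemma lin_span_class_struct: "lin_span (class_struct :: 'a::banach normed_struct) S = span S"
proof -
  interpret module real_ring "class_struct :: 'a normed_struct" by (rule module_class_struct)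
  have inv: "\<ominus>\<^bsub>class_struct\<^esub> y = - y" for y::'a by (rule M.minus_equality) (auto simp: class_struct_def)
  have "submodule H real_ring (class_struct :: 'a normed_struct) \<longleftrightarrow> subspace H" for H
  proof
    assume "submodule H real_ring (class_struct :: 'a normed_struct)"
    note s = submoduleE[OF this]
    show "subspace H" unfolding subspace_def
    proof (intro conjI ballI allI)
      show add: "x + y \<in> H" if "x\<in>H" "y \<in> H" for x y using s(5) that by (simp add: class_struct_def)
      show sc: "c *\<^sub>R x \<in> H" if "x\<in>H" for x c using s(4)[of c x] that by (simp add: class_struct_def real_ring_def)
      from s(2) obtain x where "x \<in> H" by auto
      from sc[OF this, of 0] show "0 \<in> H" by simp
    qed
  next
    assume H: "subspace H"
    show "submodule H real_ring (class_struct :: 'a normed_struct)"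
      by (rule submoduleI)
       (use H in \<open>auto simp: inv subspace_neg\<close>, auto simp: class_struct_def subspace_def)
  qed
  then show ?thesis by (simp add: lin_span_def span_def)
qed

text \<open>
  On the zero space the supremum is over the empty set and has no specified value.  This is
  harmless: every dictionary of the zero space is empty, so the algorithm has no realization there.
\<close>

definition modulus_of_smoothness :: "'a normed_struct \<Rightarrow> real \<Rightarrow> real" where
  "modulus_of_smoothness X u =
     (SUP (x, y)\<in>{(x, y). x \<in> carrier X \<and> y \<in> carrier X \<and> nrm X x = 1 \<and> nrm X y = 1}.
        (nrm X (x \<oplus>\<^bsub>X\<^esub> u \<odot>\<^bsub>X\<^esub> y) + nrm X (x \<ominus>\<^bsub>X\<^esub> u \<odot>\<^bsub>X\<^esub> y)) / 2 - 1)"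

definition power_smooth :: "real \<Rightarrow> 'a normed_struct set" where
  "power_smooth q =
     {X. banach_space X \<and> (\<exists>\<gamma>>0. \<forall>u\<ge>0. modulus_of_smoothness X u \<le> \<gamma> * u powr q)}"

definition dictionary :: "'a normed_struct \<Rightarrow> 'a set \<Rightarrow> bool" where
  "dictionary X D \<longleftrightarrow>
     D \<subseteq> carrier X \<and>
     (\<forall>g\<in>D. nrm X g = 1) \<and>
     Metric_space.mtopology (carrier X) (ndist X) closure_of lin_span X D = carrier X \<and>
     (\<forall>g\<in>D. \<ominus>\<^bsub>X\<^esub> g \<in> D)"

text \<open>
  Sequences indexed from 1 in the mathematics are functions on \<^typ>\<open>nat\<close> whose value at 0 is
  unconstrained and unused.
\<close>

definition weakness_seq :: "(nat \<Rightarrow> real) \<Rightarrow> bool" where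
  "weakness_seq t \<longleftrightarrow> (\<forall>n\<ge>1. 0 \<le> t n \<and> t n \<le> 1)"

definition perturbation_seq :: "(nat \<Rightarrow> real) \<Rightarrow> bool" where
  "perturbation_seq \<delta> \<longleftrightarrow> (\<forall>n. 0 \<le> \<delta> n \<and> \<delta> n \<le> 1)"

definition error_seq :: "(nat \<Rightarrow> real) \<Rightarrow> bool" where
  "error_seq \<eta> \<longleftrightarrow> (\<forall>n\<ge>1. 0 \<le> \<eta> n)"

definition best_approx_error :: "'a normed_struct \<Rightarrow> 'a \<Rightarrow> 'a set \<Rightarrow> real" where
  "best_approx_error X f V = (INF G\<in>V. nrm X (f \<ominus>\<^bsub>X\<^esub> G))"

text \<open>
  \<open>r\<close> is the sequence of remainders $f_n$; in step \<open>n\<close> the functional is \<open>F (n - 1)\<close>, the chosen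
  dictionary element \<open>\<phi> n\<close> and the approximant \<open>G n\<close>.
\<close>

definition awcga_realization ::
  "'a normed_struct \<Rightarrow> 'a set \<Rightarrow> (nat \<Rightarrow> real) \<Rightarrow> (nat \<Rightarrow> real) \<Rightarrow> (nat \<Rightarrow> real) \<Rightarrow> 'a \<Rightarrow>
   (nat \<Rightarrow> 'a \<Rightarrow> real) \<Rightarrow> (nat \<Rightarrow> 'a) \<Rightarrow> (nat \<Rightarrow> 'a) \<Rightarrow> (nat \<Rightarrow> 'a) \<Rightarrow> bool" where
  "awcga_realization X D t \<delta> \<eta> f F \<phi> G r \<longleftrightarrow>
     r 0 = f \<and>
     (\<forall>n\<ge>1.
        bounded_linear_functional X (F (n - 1)) \<and>
        functional_norm X (F (n - 1)) \<le> 1 \<and>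
        F (n - 1) (r (n - 1)) \<ge> (1 - \<delta> (n - 1)) * nrm X (r (n - 1)) \<and>
        \<phi> n \<in> D \<and>
        F (n - 1) (\<phi> n) \<ge> t n * (SUP g\<in>D. F (n - 1) g) \<and>
        G n \<in> lin_span X (\<phi> ` {1..n}) \<and>
        nrm X (f \<ominus>\<^bsub>X\<^esub> G n)
          \<le> (1 + \<eta> n) * best_approx_error X f (lin_span X (\<phi> ` {1..n})) \<and>
        r n = f \<ominus>\<^bsub>X\<^esub> G n)"

definition awcga_converges ::
  "'a normed_struct \<Rightarrow> 'a set \<Rightarrow> (nat \<Rightarrow> real) \<Rightarrow> (nat \<Rightarrow> real) \<Rightarrow> (nat \<Rightarrow> real) \<Rightarrow> 'a \<Rightarrow> bool" where
  "awcga_converges X D t \<delta> \<eta> f \<longleftrightarrow>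
     (\<forall>F \<phi> G r. awcga_realization X D t \<delta> \<eta> f F \<phi> G r \<longrightarrow> (\<lambda>n. nrm X (r n)) \<longlonglongrightarrow> 0)"

definition nonneg_little_o :: "(nat \<Rightarrow> real) \<Rightarrow> (nat \<Rightarrow> real) \<Rightarrow> bool" where
  "nonneg_little_o a b \<longleftrightarrow> (\<exists>\<epsilon>. \<epsilon> \<longlonglongrightarrow> 0 \<and> (\<forall>k. a k \<le> \<epsilon> k * b k))"

end

theory Submission
  imports Defs
begin

text \<open>
  Write \<open>E\<^sub>n\<close> for the distance from \<open>f\<close> to \<open>\<Phi>\<^sub>n\<close> and \<open>s\<^sub>n = t\<^bsub>n+1\<^esub>\<^sup>p\<close>.

  \<^bold>\<open>The condition suffices.\<close>  In a space of power type \<open>q\<close>, moving from the remainder by \<open>\<tau>\<close> along the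
  chosen dictionary element gains about \<open>\<tau> t\<^bsub>n+1\<^esub> sup\<^sub>D F\<^sub>n\<close> and loses \<open>O(\<tau>\<^sup>q)\<close>, besides the cost
  \<open>O(\<delta>\<^sub>n + \<eta>\<^sub>n)\<close> of the inexact functional and approximant.  The best \<open>\<tau>\<close> is a multiple of
  \<open>t\<^bsub>n+1\<^esub>\<close> to the power \<open>1/(q-1)\<close>, and then the gain is a multiple of \<open>s\<^sub>n\<close>.  If \<open>E\<^sub>n\<close> stays away
  from 0, so does \<open>sup\<^sub>D F\<^sub>n\<close> along the subsequence, because \<open>F\<^sub>n\<close> is then almost
  orthogonal to \<open>\<Phi>\<^sub>n\<close> and so cannot be small at \<open>f\<close>.  Each step of the subsequence eventually lowers
  \<open>E\<^sub>n\<close> by a multiple of \<open>s\<^sub>n\<close>, against \<open>\<Sum> s\<^sub>n = \<infinity>\<close>.  The lemma \<open>greedy_descent\<close> is the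
  one-step estimate, \<open>awcga_converges_along_subsequence\<close> the conclusion.

  \<^bold>\<open>The condition is necessary.\<close>  If no such subsequence exists, a diagonal argument
  (\<open>subsequence_of_divergent_sums\<close>) yields \<open>\<alpha> > 0\<close> such that \<open>s\<^sub>n\<close> is summable over the indices
  with \<open>\<delta>\<^sub>n + \<eta>\<^sub>n \<le> \<alpha> s\<^sub>n\<close>.  The sequence space $\ell_q$ with the signed unit vectors as dictionary then
  has a divergent realization (\<open>divergent_realization\<close>).  At the summable indices the algorithm is
  distracted by a small extra coordinate of \<open>f\<close>; at each of the others \<open>\<delta>\<^sub>n\<close> or \<open>\<eta>\<^sub>n\<close> is at least
  \<open>\<alpha> s\<^sub>n / 2\<close>, which is enough to make it pick an old dictionary element again.  That $\ell_q$ has power type \<open>q\<close> for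
  \<open>q \<le> 2\<close> follows from \<open>\<bar>a + b\<bar>\<^sup>q + \<bar>a - b\<bar>\<^sup>q \<le> 2 (\<bar>a\<bar>\<^sup>q + \<bar>b\<bar>\<^sup>q)\<close>, summed over the coordinates.
\<close>

section \<open>Normed spaces with a power-type modulus of smoothness\<close>

locale normed_vspace =
  fixes X :: "'a normed_struct"
  assumes normed: "real_normed_space X"
begin

sublocale module real_ring X
  using normed by (simp add: real_normed_space_def)

lemma real_ring_simps [simp]:
  "carrier real_ring = UNIV" "a \<oplus>\<^bsub>real_ring\<^esub> b = a + b" "a \<otimes>\<^bsub>real_ring\<^esub> b = a * b"
  "\<one>\<^bsub>real_ring\<^esub> = 1" "\<zero>\<^bsub>real_ring\<^esub> = 0"
  by (auto simp: real_ring_def)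

lemma nrm_eq_0: "x \<in> carrier X \<Longrightarrow> nrm X x = 0 \<longleftrightarrow> x = \<zero>\<^bsub>X\<^esub>"
  and nrm_smult: "x \<in> carrier X \<Longrightarrow> nrm X (a \<odot>\<^bsub>X\<^esub> x) = \<bar>a\<bar> * nrm X x"
  and nrm_triangle: "x \<in> carrier X \<Longrightarrow> y \<in> carrier X \<Longrightarrow> nrm X (x \<oplus>\<^bsub>X\<^esub> y) \<le> nrm X x + nrm X y"
  using normed by (auto simp: real_normed_space_def)

lemma smult_in [simp, intro]: "x \<in> carrier X \<Longrightarrow> a \<odot>\<^bsub>X\<^esub> x \<in> carrier X"
  by (rule smult_closed) simp

lemma neg_smult: "x \<in> carrier X \<Longrightarrow> \<ominus>\<^bsub>X\<^esub> x = (- 1) \<odot>\<^bsub>X\<^esub> x"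
proof -
  assume x: "x \<in> carrier X"
  have "(- 1) \<odot>\<^bsub>X\<^esub> x \<oplus>\<^bsub>X\<^esub> x = \<zero>\<^bsub>X\<^esub>"
    using smult_l_distr[of "-1" 1 x] smult_one[of x] smult_l_null[of x] x by simp
  then show ?thesis by (rule M.minus_equality) (use x in auto)
qed

lemma smult_smult: "x \<in> carrier X \<Longrightarrow> a \<odot>\<^bsub>X\<^esub> (b \<odot>\<^bsub>X\<^esub> x) = (a * b) \<odot>\<^bsub>X\<^esub> x"
  using smult_assoc1[of a b x] by simp

lemma smult_one' [simp]: "x \<in> carrier X \<Longrightarrow> 1 \<odot>\<^bsub>X\<^esub> x = x"
  using smult_one[of x] by simp

lemma smult_add: "x \<in> carrier X \<Longrightarrow> y \<in> carrier X \<Longrightarrow> a \<odot>\<^bsub>X\<^esub> (x \<oplus>\<^bsub>X\<^esub> y) = a \<odot>\<^bsub>X\<^esub> x \<oplus>\<^bsub>X\<^esub> a \<odot>\<^bsub>X\<^esub> y"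
  using smult_r_distr[of a x y] by simp

lemma minus_conv: "x \<in> carrier X \<Longrightarrow> y \<in> carrier X \<Longrightarrow> x \<ominus>\<^bsub>X\<^esub> y = x \<oplus>\<^bsub>X\<^esub> (- 1) \<odot>\<^bsub>X\<^esub> y"
  by (simp add: a_minus_def neg_smult)

lemma smult_minus: "x \<in> carrier X \<Longrightarrow> y \<in> carrier X \<Longrightarrow> a \<odot>\<^bsub>X\<^esub> (x \<ominus>\<^bsub>X\<^esub> y) = a \<odot>\<^bsub>X\<^esub> x \<ominus>\<^bsub>X\<^esub> a \<odot>\<^bsub>X\<^esub> y"
  by (simp add: minus_conv smult_add smult_smult)

lemma nrm_nonneg [simp]: "x \<in> carrier X \<Longrightarrow> 0 \<le> nrm X x"
  using nrm_triangle[of x "(-1) \<odot>\<^bsub>X\<^esub> x"] nrm_smult[of x "-1"] nrm_eq_0[of "\<zero>\<^bsub>X\<^esub>"]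
    M.r_neg[of x] neg_smult[of x] by simp

lemma nrm_minus_le: "x \<in> carrier X \<Longrightarrow> y \<in> carrier X \<Longrightarrow> nrm X (x \<ominus>\<^bsub>X\<^esub> y) \<le> nrm X x + nrm X y"
  using nrm_triangle[of x "(-1) \<odot>\<^bsub>X\<^esub> y"] by (simp add: minus_conv nrm_smult)

text \<open>
The modulus only speaks of unit vectors; rescaling by \<open>1 / \<parallel>x\<parallel>\<close> and \<open>1 / \<parallel>y\<parallel>\<close> turns its power
bound into an inequality for all \<open>x \<noteq> 0\<close> and all \<open>y\<close>.
\<close>

lemma power_type_inequality:
  assumes smooth: "\<forall>u\<ge>0. modulus_of_smoothness X u \<le> \<gamma> * u powr q"
    and x: "x \<in> carrier X" "0 < nrm X x" and y: "y \<in> carrier X" and "0 \<le> \<gamma>"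
  shows "nrm X (x \<oplus>\<^bsub>X\<^esub> y) + nrm X (x \<ominus>\<^bsub>X\<^esub> y)
    \<le> 2 * nrm X x + 2 * \<gamma> * nrm X y powr q * nrm X x powr (1 - q)"
proof (cases "nrm X y = 0")
  case True
  then have "nrm X (x \<oplus>\<^bsub>X\<^esub> y) \<le> nrm X x" "nrm X (x \<ominus>\<^bsub>X\<^esub> y) \<le> nrm X x"
    using nrm_triangle[of x y] nrm_minus_le[of x y] x y by auto
  moreover have "0 \<le> 2 * \<gamma> * nrm X y powr q * nrm X x powr (1 - q)" using \<open>0 \<le> \<gamma>\<close> by simp
  ultimately show ?thesis by linarith
next
  case False
  define a b where "a = nrm X x" and "b = nrm X y"
  have ab: "0 < a" "0 < b" using x False nrm_nonneg[OF y] by (simp_all add: a_def b_def)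
  define x' y' u where "x' = (1 / a) \<odot>\<^bsub>X\<^esub> x" and "y' = (1 / b) \<odot>\<^bsub>X\<^esub> y" and "u = b / a"
  have c: "x' \<in> carrier X" "y' \<in> carrier X" using x y by (auto simp: x'_def y'_def)
  have n1: "nrm X x' = 1" "nrm X y' = 1"
    using x y ab by (simp_all add: x'_def y'_def nrm_smult a_def b_def)
  let ?S = "{(x, y). x \<in> carrier X \<and> y \<in> carrier X \<and> nrm X x = 1 \<and> nrm X y = 1}"
  let ?h = "\<lambda>(x, y). (nrm X (x \<oplus>\<^bsub>X\<^esub> u \<odot>\<^bsub>X\<^esub> y) + nrm X (x \<ominus>\<^bsub>X\<^esub> u \<odot>\<^bsub>X\<^esub> y)) / 2 - 1"
  have "bdd_above (?h ` ?S)"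
  proof (rule bdd_aboveI2[where M="\<bar>u\<bar>"], clarify)
    fix v w assume "v \<in> carrier X" "w \<in> carrier X" "nrm X v = 1" "nrm X w = 1"
    then have "nrm X (v \<oplus>\<^bsub>X\<^esub> u \<odot>\<^bsub>X\<^esub> w) \<le> 1 + \<bar>u\<bar>" "nrm X (v \<ominus>\<^bsub>X\<^esub> u \<odot>\<^bsub>X\<^esub> w) \<le> 1 + \<bar>u\<bar>"
      using nrm_triangle[of v "u \<odot>\<^bsub>X\<^esub> w"] nrm_minus_le[of v "u \<odot>\<^bsub>X\<^esub> w"] by (auto simp: nrm_smult)
    then show "(nrm X (v \<oplus>\<^bsub>X\<^esub> u \<odot>\<^bsub>X\<^esub> w) + nrm X (v \<ominus>\<^bsub>X\<^esub> u \<odot>\<^bsub>X\<^esub> w)) / 2 - 1 \<le> \<bar>u\<bar>"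
      by argo
  qed
  then have "?h (x', y') \<le> modulus_of_smoothness X u"
    unfolding modulus_of_smoothness_def by (rule cSUP_upper[rotated]) (use c n1 in auto)
  also have "\<dots> \<le> \<gamma> * u powr q" using smooth ab by (simp add: u_def)
  finally have main: "nrm X (x' \<oplus>\<^bsub>X\<^esub> u \<odot>\<^bsub>X\<^esub> y') + nrm X (x' \<ominus>\<^bsub>X\<^esub> u \<odot>\<^bsub>X\<^esub> y') \<le> 2 + 2 * \<gamma> * u powr q"
    unfolding case_prod_conv by (simp add: field_simps)
  have xe: "a \<odot>\<^bsub>X\<^esub> x' = x" and ye: "a \<odot>\<^bsub>X\<^esub> (u \<odot>\<^bsub>X\<^esub> y') = y"
    using ab x y c by (simp_all add: x'_def y'_def u_def smult_smult)
  have e1: "nrm X (x \<oplus>\<^bsub>X\<^esub> y) = a * nrm X (x' \<oplus>\<^bsub>X\<^esub> u \<odot>\<^bsub>X\<^esub> y')"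
    using nrm_smult[of "x' \<oplus>\<^bsub>X\<^esub> u \<odot>\<^bsub>X\<^esub> y'" a] c ab by (simp add: smult_add xe ye)
  have e2: "nrm X (x \<ominus>\<^bsub>X\<^esub> y) = a * nrm X (x' \<ominus>\<^bsub>X\<^esub> u \<odot>\<^bsub>X\<^esub> y')"
    using nrm_smult[of "x' \<ominus>\<^bsub>X\<^esub> u \<odot>\<^bsub>X\<^esub> y'" a] c ab by (simp add: smult_minus xe ye)
  have "nrm X (x \<oplus>\<^bsub>X\<^esub> y) + nrm X (x \<ominus>\<^bsub>X\<^esub> y) \<le> a * (2 + 2 * \<gamma> * u powr q)"
    using mult_left_mono[OF main, of a] ab by (simp add: e1 e2 algebra_simps)
  also have "a * u powr q = b powr q * a powr (1 - q)"
    using ab by (simp add: u_def powr_divide powr_diff)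
  then have "a * (2 + 2 * \<gamma> * u powr q) = 2 * a + 2 * \<gamma> * b powr q * a powr (1 - q)"
    by (simp add: algebra_simps)
  finally show ?thesis by (simp add: a_def b_def)
qed

lemma lin_span_minimal: "S \<subseteq> H \<Longrightarrow> submodule H real_ring X \<Longrightarrow> lin_span X S \<subseteq> H"
  unfolding lin_span_def by (rule hull_minimal)

lemma lin_span_superset: "S \<subseteq> lin_span X S"
  unfolding lin_span_def by (rule hull_subset)

lemma lin_span_mono: "S \<subseteq> T \<Longrightarrow> lin_span X S \<subseteq> lin_span X T"
  unfolding lin_span_def by (rule hull_mono)

lemma submodule_lin_span:
  assumes "S \<subseteq> carrier X" shows "submodule (lin_span X S) real_ring X"
proof (rule submoduleI)
  show "lin_span X S \<subseteq> carrier X"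
    using lin_span_minimal[OF assms carrier_is_submodule] .
  show "\<zero>\<^bsub>X\<^esub> \<in> lin_span X S"
    unfolding lin_span_def hull_def
  proof (clarify)
    fix H assume "submodule H real_ring X"
    from submoduleE[OF this] obtain x where x: "x \<in> H" "x \<in> carrier X" by blast
    from submoduleE(4)[OF \<open>submodule H real_ring X\<close>, of 0 x] x smult_l_null[of x]
    show "\<zero>\<^bsub>X\<^esub> \<in> H" by simp
  qed
qed (auto simp: lin_span_def hull_def submoduleE)

lemma lin_span_closed:
  assumes "S \<subseteq> carrier X"
  shows "lin_span X S \<subseteq> carrier X" "\<zero>\<^bsub>X\<^esub> \<in> lin_span X S"
    "x \<in> lin_span X S \<Longrightarrow> a \<odot>\<^bsub>X\<^esub> x \<in> lin_span X S"
    "x \<in> lin_span X S \<Longrightarrow> y \<in> lin_span X S \<Longrightarrow> x \<oplus>\<^bsub>X\<^esub> y \<in> lin_span X S"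
proof -
  note s = submodule_lin_span[OF assms]
  show "lin_span X S \<subseteq> carrier X" using submoduleE(1)[OF s] .
  then show "\<zero>\<^bsub>X\<^esub> \<in> lin_span X S"
    using submoduleE(2)[OF s] submoduleE(4)[OF s, of 0] smult_l_null
    by (metis UNIV_I all_not_in_conv real_ring_simps(1,5) subsetD)
  show "x \<in> lin_span X S \<Longrightarrow> a \<odot>\<^bsub>X\<^esub> x \<in> lin_span X S" using submoduleE(4)[OF s] by simp
  show "x \<in> lin_span X S \<Longrightarrow> y \<in> lin_span X S \<Longrightarrow> x \<oplus>\<^bsub>X\<^esub> y \<in> lin_span X S"
    using submoduleE(5)[OF s] .
qed

lemma functional_minus:
  assumes "linear_functional X F" "x \<in> carrier X" "y \<in> carrier X"
  shows "F (x \<ominus>\<^bsub>X\<^esub> y) = F x - F y"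
  using assms by (simp add: minus_conv linear_functional_def)

lemma functional_le_norm:
  assumes "bounded_linear_functional X F" "functional_norm X F \<le> 1" and x: "x \<in> carrier X"
  shows "\<bar>F x\<bar> \<le> nrm X x"
proof (cases "nrm X x = 0")
  case True
  with assms show ?thesis unfolding bounded_linear_functional_def by force
next
  case False
  then have pos: "0 < nrm X x" using nrm_nonneg[OF x] by linarith
  from assms obtain K where K: "\<And>x. x \<in> carrier X \<Longrightarrow> \<bar>F x\<bar> \<le> K * nrm X x"
    and lin: "linear_functional X F" by (auto simp: bounded_linear_functional_def)
  let ?y = "(1 / nrm X x) \<odot>\<^bsub>X\<^esub> x"
  have y: "?y \<in> carrier X" "nrm X ?y = 1" using x pos by (auto simp: nrm_smult)
  have bd: "bdd_above ((\<lambda>x. \<bar>F x\<bar>) ` {x \<in> carrier X. nrm X x \<le> 1})"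
  proof (rule bdd_aboveI2[where M="\<bar>K\<bar>"], clarify)
    fix z assume z: "z \<in> carrier X" "nrm X z \<le> 1"
    have "K * nrm X z \<le> \<bar>K\<bar> * 1" by (intro mult_mono) (use z in auto)
    with K[OF z(1)] show "\<bar>F z\<bar> \<le> \<bar>K\<bar>" by linarith
  qed
  have "\<bar>F ?y\<bar> \<le> functional_norm X F"
    unfolding functional_norm_def by (rule cSUP_upper[OF _ bd]) (use y in auto)
  also have "F ?y = F x / nrm X x" using lin x by (simp add: linear_functional_def)
  finally have "\<bar>F x / nrm X x\<bar> \<le> 1" using assms(2) by linarith
  then show ?thesis using pos by (simp add: field_simps)
qed

text \<open>
The vectors \<open>v\<close> for which such an \<open>A\<close> exists form a subspace, and by symmetry of the dictionary the
subspace contains every \<open>g \<in> D\<close> with \<open>A = 1\<close>.  The constant depends on \<open>v\<close> alone, so one \<open>A\<close> serves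
all the functionals that a realization uses.
\<close>

lemma dictionary_sup_dominates_span:
  assumes D: "dictionary X D" and "D \<noteq> {}" and v: "v \<in> lin_span X D"
  shows "\<exists>A\<ge>0. \<forall>F. bounded_linear_functional X F \<longrightarrow> functional_norm X F \<le> 1 \<longrightarrow> \<bar>F v\<bar> \<le> A * (SUP g\<in>D. F g)"
proof -
  define good where "good v A \<longleftrightarrow> 0 \<le> A \<and> (\<forall>F. bounded_linear_functional X F \<longrightarrow> functional_norm X F \<le> 1 \<longrightarrow>
    \<bar>F v\<bar> \<le> A * (SUP g\<in>D. F g))" for v A
  let ?H = "{v \<in> carrier X. \<exists>A. good v A}"
  have DX: "D \<subseteq> carrier X" and D1: "\<And>g. g \<in> D \<Longrightarrow> nrm X g = 1" and Dneg: "\<And>g. g \<in> D \<Longrightarrow> \<ominus>\<^bsub>X\<^esub> g \<in> D"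
    using D by (auto simp: dictionary_def)
  have scale: "good (a \<odot>\<^bsub>X\<^esub> v) (\<bar>a\<bar> * A)" if "good v A" "v \<in> carrier X" for a v A
    unfolding good_def
  proof (intro conjI allI impI)
    show "0 \<le> \<bar>a\<bar> * A" using that by (simp add: good_def)
    fix F assume F: "bounded_linear_functional X F" "functional_norm X F \<le> 1"
    then have "F (a \<odot>\<^bsub>X\<^esub> v) = a * F v"
      using that by (simp add: bounded_linear_functional_def linear_functional_def)
    moreover have "\<bar>F v\<bar> \<le> A * (SUP g\<in>D. F g)" using that F by (simp add: good_def)
    ultimately show "\<bar>F (a \<odot>\<^bsub>X\<^esub> v)\<bar> \<le> \<bar>a\<bar> * A * (SUP g\<in>D. F g)"
      by (simp add: abs_mult mult.assoc mult_left_mono)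
  qed
  have "submodule ?H real_ring X"
  proof (rule submoduleI)
    show "?H \<subseteq> carrier X" by auto
    have z: "\<zero>\<^bsub>X\<^esub> = 0 \<odot>\<^bsub>X\<^esub> \<zero>\<^bsub>X\<^esub>" using smult_l_null[of "\<zero>\<^bsub>X\<^esub>"] by simp
    have "F \<zero>\<^bsub>X\<^esub> = 0" if "bounded_linear_functional X F" for F
      using that by (subst z) (simp only: bounded_linear_functional_def linear_functional_def M.zero_closed mult_zero_left)
    then have "good \<zero>\<^bsub>X\<^esub> 0" by (simp add: good_def)
    then show "\<zero>\<^bsub>X\<^esub> \<in> ?H" by auto
    show "\<ominus>\<^bsub>X\<^esub> v \<in> ?H" if "v \<in> ?H" for v using that scale[of v _ "-1"] neg_smult[of v] by auto
    show "a \<odot>\<^bsub>X\<^esub> v \<in> ?H" if "v \<in> ?H" for v a using that scale[of v _ a] by auto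
    show "v \<oplus>\<^bsub>X\<^esub> w \<in> ?H" if vw: "v \<in> ?H" "w \<in> ?H" for v w
    proof -
      from vw obtain A B where AB: "good v A" "good w B" by auto
      have "good (v \<oplus>\<^bsub>X\<^esub> w) (A + B)"
        unfolding good_def
      proof (intro conjI allI impI)
        show "0 \<le> A + B" using AB by (simp add: good_def)
        fix F assume F: "bounded_linear_functional X F" "functional_norm X F \<le> 1"
        then have "F (v \<oplus>\<^bsub>X\<^esub> w) = F v + F w"
          using vw by (simp add: bounded_linear_functional_def linear_functional_def)
        moreover have "\<bar>F v\<bar> \<le> A * (SUP g\<in>D. F g)" "\<bar>F w\<bar> \<le> B * (SUP g\<in>D. F g)" using AB F by (simp_all add: good_def)
        ultimately show "\<bar>F (v \<oplus>\<^bsub>X\<^esub> w)\<bar> \<le> (A + B) * (SUP g\<in>D. F g)"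
          by (simp add: algebra_simps)
      qed
      with vw show ?thesis by auto
    qed
  qed
  moreover have "D \<subseteq> ?H"
  proof
    fix g assume g: "g \<in> D"
    have "good g 1" unfolding good_def
    proof (intro conjI allI impI)
      fix F assume F: "bounded_linear_functional X F" "functional_norm X F \<le> 1"
      have "bdd_above (F ` D)"
        using functional_le_norm[OF F] D1 DX by (intro bdd_aboveI2[where M=1]) force
      then have "F h \<le> (SUP g\<in>D. F g)" if "h \<in> D" for h using that by (simp add: cSUP_upper)
      from this[OF g] this[OF Dneg[OF g]] show "\<bar>F g\<bar> \<le> 1 * (SUP g\<in>D. F g)"
        using F g DX neg_smult[of g] by (auto simp: bounded_linear_functional_def linear_functional_def)
    qed simp
    then show "g \<in> ?H" using g DX by auto
  qed
  ultimately have "lin_span X D \<subseteq> ?H" by (intro lin_span_minimal)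
  with v obtain A where "good v A" by auto
  then show ?thesis by (auto simp: good_def)
qed

text \<open>
How smoothness enters the algorithm: since \<open>\<parallel>x + y\<parallel> \<ge> F (x + y)\<close> is large when \<open>F\<close> almost norms
\<open>x\<close>, the inequality above forces \<open>\<parallel>x - y\<parallel>\<close> down to about \<open>\<parallel>x\<parallel> - F y\<close>, with an error of order
\<open>\<parallel>y\<parallel>\<^sup>q\<close>.
\<close>

lemma almost_norming_descent:
  assumes smooth: "\<forall>u\<ge>0. modulus_of_smoothness X u \<le> \<gamma> * u powr q" "0 \<le> \<gamma>"
    and F: "bounded_linear_functional X F" "functional_norm X F \<le> 1"
    and x: "x \<in> carrier X" "0 < nrm X x" and y: "y \<in> carrier X"
    and nrmg: "(1 - d) * nrm X x \<le> F x"
  shows "nrm X (x \<ominus>\<^bsub>X\<^esub> y) \<le> (1 + d) * nrm X x - F y + 2 * \<gamma> * nrm X y powr q * nrm X x powr (1 - q)"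
proof -
  have "F (x \<oplus>\<^bsub>X\<^esub> y) = F x + F y"
    using F x y by (simp add: bounded_linear_functional_def linear_functional_def)
  moreover have "F (x \<oplus>\<^bsub>X\<^esub> y) \<le> nrm X (x \<oplus>\<^bsub>X\<^esub> y)"
    using functional_le_norm[OF F, of "x \<oplus>\<^bsub>X\<^esub> y"] x y by simp
  moreover note power_type_inequality[OF smooth(1) x y smooth(2)]
  ultimately show ?thesis using nrmg by (simp add: algebra_simps)
qed


lemma best_approx_error_le:
  assumes "f \<in> carrier X" "V \<subseteq> carrier X" "G \<in> V"
  shows "best_approx_error X f V \<le> nrm X (f \<ominus>\<^bsub>X\<^esub> G)"
  unfolding best_approx_error_def
  by (rule cINF_lower) (use assms in \<open>auto intro!: bdd_belowI2[where m=0] nrm_nonneg\<close>)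

lemma best_approx_error_nonneg:
  assumes "f \<in> carrier X" "V \<subseteq> carrier X" "V \<noteq> {}"
  shows "0 \<le> best_approx_error X f V"
  unfolding best_approx_error_def
  by (rule cINF_greatest) (use assms in \<open>auto intro!: nrm_nonneg\<close>)

lemma best_approx_error_antimono:
  assumes "f \<in> carrier X" "V \<subseteq> W" "W \<subseteq> carrier X" "V \<noteq> {}"
  shows "best_approx_error X f W \<le> best_approx_error X f V"
  unfolding best_approx_error_def
  by (rule cINF_superset_mono) (use assms in \<open>auto intro!: bdd_belowI2[where m=0] nrm_nonneg\<close>)

text \<open>
One inequality that is used twice.  With \<open>y \<in> V\<close> the left side is at least the best error of \<open>V\<close>,
so \<open>F\<close> is almost orthogonal to \<open>V\<close>.  With \<open>y\<close> a multiple of the next dictionary element it bounds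
the best error of the next, larger space.  The term \<open>2 * h\<close> covers \<open>h + d * h\<close> because \<open>d \<le> 1\<close>.
\<close>

lemma greedy_descent:
  assumes smooth: "\<forall>u\<ge>0. modulus_of_smoothness X u \<le> \<gamma> * u powr q" "0 \<le> \<gamma>" "1 < q"
    and F: "bounded_linear_functional X F" "functional_norm X F \<le> 1"
    and f: "f \<in> carrier X" and V: "V \<subseteq> carrier X" and G: "G \<in> V"
    and d: "0 \<le> d" "d \<le> 1" and h: "0 \<le> h"
    and e: "0 < e" "e \<le> best_approx_error X f V"
    and near: "nrm X (f \<ominus>\<^bsub>X\<^esub> G) \<le> (1 + h) * best_approx_error X f V"
    and nrmg: "(1 - d) * nrm X (f \<ominus>\<^bsub>X\<^esub> G) \<le> F (f \<ominus>\<^bsub>X\<^esub> G)"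
    and y: "y \<in> carrier X"
  shows "nrm X (f \<ominus>\<^bsub>X\<^esub> (G \<oplus>\<^bsub>X\<^esub> y)) \<le> (1 + d + 2 * h) * best_approx_error X f V - F y
    + 2 * \<gamma> * nrm X y powr q * e powr (1 - q)"
proof -
  define E where "E = best_approx_error X f V"
  define r where "r = f \<ominus>\<^bsub>X\<^esub> G"
  have GX: "G \<in> carrier X" and r: "r \<in> carrier X" using G V f by (auto simp: r_def)
  have Er: "E \<le> nrm X r" unfolding E_def r_def by (rule best_approx_error_le[OF f V G])
  have pos: "0 < nrm X r" using Er e by (simp add: E_def)
  have "f \<ominus>\<^bsub>X\<^esub> (G \<oplus>\<^bsub>X\<^esub> y) = r \<ominus>\<^bsub>X\<^esub> y"
    using f GX y unfolding r_def by (simp add: minus_conv smult_add M.a_assoc)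
  then have "nrm X (f \<ominus>\<^bsub>X\<^esub> (G \<oplus>\<^bsub>X\<^esub> y)) \<le> (1 + d) * nrm X r - F y + 2 * \<gamma> * nrm X y powr q * nrm X r powr (1 - q)"
    using almost_norming_descent[OF smooth(1,2) F r pos y nrmg[folded r_def]] by simp
  moreover have "2 * \<gamma> * nrm X y powr q * nrm X r powr (1 - q) \<le> 2 * \<gamma> * nrm X y powr q * e powr (1 - q)"
    using smooth e Er by (intro mult_left_mono powr_mono2') (auto simp: E_def)
  moreover have "(1 + d) * nrm X r \<le> (1 + d + 2 * h) * E"
  proof -
    have "(1 + d) * nrm X r \<le> (1 + d) * ((1 + h) * E)"
      using near d by (intro mult_left_mono) (auto simp: E_def r_def)
    also have "\<dots> \<le> (1 + d + 2 * h) * E"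
    proof -
      have "d * h \<le> 1 * h" by (rule mult_right_mono) (use d h in auto)
      then have "(1 + d) * (1 + h) \<le> 1 + d + 2 * h" by (simp add: algebra_simps)
      from mult_right_mono[OF this, of E] e show ?thesis by (simp add: E_def mult.assoc)
    qed
    finally show ?thesis .
  qed
  ultimately show ?thesis by (simp add: E_def)
qed

end

section \<open>Convergence along a subsequence\<close>

text \<open>
The gain of a greedy step is linear in the step length and the loss is of order \<open>q > 1\<close>, so short
steps pay off.
\<close>

lemma ex_small_step:
  fixes C c q :: real
  assumes "0 \<le> C" "0 < c" "1 < q"
  shows "\<exists>\<mu>>0. C * \<mu> powr q \<le> c * \<mu>"
proof -
  define \<mu> where "\<mu> = (c / (C + 1)) powr (1 / (q - 1))"
  have pos: "0 < \<mu>" using assms by (simp add: \<mu>_def)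
  have "\<mu> powr (q - 1) = c / (C + 1)" using assms by (simp add: \<mu>_def powr_powr)
  then have "\<mu> powr q = \<mu> * (c / (C + 1))"
    using powr_mult_base[of \<mu> "q - 1"] pos by simp
  then have "C * \<mu> powr q = c * \<mu> * (C / (C + 1))" by simp
  also have "\<dots> \<le> c * \<mu> * 1" using assms pos by (intro mult_left_mono) auto
  finally show ?thesis using pos by auto
qed

text \<open>
Between consecutive members of the subsequence \<open>E\<close> does not increase, so the descents telescope.
\<close>

lemma bounded_sums_of_descent:
  fixes E :: "nat \<Rightarrow> real" and s :: "nat \<Rightarrow> real"
  assumes n: "strict_mono n" and E: "\<And>i j. n 0 \<le> i \<Longrightarrow> i \<le> j \<Longrightarrow> E j \<le> E i" "\<And>i. n 0 \<le> i \<Longrightarrow> 0 \<le> E i"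
    and \<kappa>: "0 < \<kappa>" and desc: "\<forall>\<^sub>F k in sequentially. E (n k + 1) \<le> E (n k) - \<kappa> * s k"
  shows "\<not> filterlim (\<lambda>K. \<Sum>k<K. s k) at_top sequentially"
proof
  assume lim: "filterlim (\<lambda>K. \<Sum>k<K. s k) at_top sequentially"
  from desc obtain k0 where k0: "\<And>k. k \<ge> k0 \<Longrightarrow> E (n k + 1) \<le> E (n k) - \<kappa> * s k"
    by (auto simp: eventually_sequentially)
  have n0: "n 0 \<le> n k" for k using n by (simp add: strict_mono_less_eq)
  have step: "E (n (Suc k)) \<le> E (n k) - \<kappa> * s k" if "k \<ge> k0" for k
  proof -
    have "n k + 1 \<le> n (Suc k)" using n by (simp add: strict_mono_Suc_iff Suc_le_eq)
    then have "E (n (Suc k)) \<le> E (n k + 1)" using n0[of k] by (intro E(1)) auto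
    with k0[OF that] show ?thesis by simp
  qed
  have tel: "E (n K) + \<kappa> * (\<Sum>k<K. s k) \<le> E (n k0) + \<kappa> * (\<Sum>k<k0. s k)" if "K \<ge> k0" for K
    using that
  proof (induction K rule: dec_induct)
    case (step K)
    then show ?case using \<open>k0 \<le> K \<Longrightarrow> E (n (Suc K)) \<le> E (n K) - \<kappa> * s K\<close> by (simp add: algebra_simps)
  qed simp
  define B where "B = (E (n k0) + \<kappa> * (\<Sum>k<k0. s k)) / \<kappa>"
  have "(\<Sum>k<K. s k) \<le> B" if "K \<ge> k0" for K
    using tel[OF that] E(2)[OF n0, of K] \<kappa> by (simp add: B_def field_simps)
  moreover from lim obtain K1 where "\<And>K. K \<ge> K1 \<Longrightarrow> (\<Sum>k<K. s k) \<ge> B + 1"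
    by (auto simp: filterlim_at_top eventually_sequentially)
  ultimately have "B + 1 \<le> B" by (meson max.cobounded1 max.cobounded2 order_trans)
  then show False by simp
qed

lemma nonneg_little_oD:
  assumes "nonneg_little_o a s" "\<And>k. 0 \<le> s k" "0 < c"
  shows "\<forall>\<^sub>F k in sequentially. a k \<le> c * s k"
proof -
  from assms(1) obtain \<epsilon> where \<epsilon>: "\<epsilon> \<longlonglongrightarrow> 0" "\<And>k. a k \<le> \<epsilon> k * s k"
    by (auto simp: nonneg_little_o_def)
  from order_tendstoD(2)[OF \<epsilon>(1) \<open>0 < c\<close>] show ?thesis
  proof eventually_elim
    case (elim k)
    then have "\<epsilon> k * s k \<le> c * s k" using assms(2) by (intro mult_right_mono) auto
    with \<epsilon>(2)[of k] show ?case by simp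
  qed
qed

text \<open>
Best errors \<open>E n\<close> decrease, and \<open>\<parallel>f\<^sub>n\<parallel>\<close> is at most a constant times \<open>E n\<close>; so let \<open>E n \<ge> e > 0\<close> for
all \<open>n\<close>.  Along the subsequence the functional is almost orthogonal to the approximant \<open>G\<close>, hence
stays bounded below at \<open>f\<close>, and hence also at a fixed element of the span of \<open>D\<close> near \<open>f\<close>.
So the supremum over \<open>D\<close> is at least a constant \<open>c > 0\<close>, and a step of length
\<open>\<mu> * t powr (1 / (q - 1))\<close> along the chosen element lowers the best error by a
multiple of \<open>t powr p\<close>.  As these powers have a divergent sum, the best error would become negative.
\<close>

theorem awcga_converges_along_subsequence:
  fixes X :: "'a normed_struct"
  assumes q: "1 < q" "p = q / (q - 1)" and X: "X \<in> power_smooth q"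
    and D: "dictionary X D" and f: "f \<in> carrier X"
    and t: "weakness_seq t" and \<delta>: "perturbation_seq \<delta>" and \<eta>: "error_seq \<eta>" and bd: "bounded (\<eta> ` {1..})"
    and n: "strict_mono n" "\<And>k. 1 \<le> n k"
    and div: "filterlim (\<lambda>K. \<Sum>k<K. t (n k + 1) powr p) at_top sequentially"
    and od: "nonneg_little_o (\<lambda>k. \<delta> (n k)) (\<lambda>k. t (n k + 1) powr p)"
    and oe: "nonneg_little_o (\<lambda>k. \<eta> (n k)) (\<lambda>k. t (n k + 1) powr p)"
  shows "awcga_converges X D t \<delta> \<eta> f"
  unfolding awcga_converges_def
proof (intro allI impI)
  fix F \<phi> G r assume real: "awcga_realization X D t \<delta> \<eta> f F \<phi> G r"
  from X obtain \<gamma> where norm: "real_normed_space X"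
    and \<gamma>: "0 < \<gamma>" "\<forall>u\<ge>0. modulus_of_smoothness X u \<le> \<gamma> * u powr q"
    by (auto simp: power_smooth_def banach_space_def)
  interpret normed_vspace X using norm by unfold_locales
  define \<Phi> where "\<Phi> n = lin_span X (\<phi> ` {1..n})" for n
  define E where "E n = best_approx_error X f (\<Phi> n)" for n
  have DX: "D \<subseteq> carrier X" and D1: "\<And>g. g \<in> D \<Longrightarrow> nrm X g = 1" using D by (auto simp: dictionary_def)
  have F: "bounded_linear_functional X (F n)" "functional_norm X (F n) \<le> 1"
    and Fr: "(1 - \<delta> n) * nrm X (r n) \<le> F n (r n)"
    and F\<phi>: "t (Suc n) * (SUP g\<in>D. F n g) \<le> F n (\<phi> (Suc n))" for n
    using real by (auto simp: awcga_realization_def dest!: spec[where x="Suc n"])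
  have \<phi>D: "\<phi> n \<in> D" and GV: "G n \<in> \<Phi> n" and near: "nrm X (r n) \<le> (1 + \<eta> n) * E n"
    and r: "r n = f \<ominus>\<^bsub>X\<^esub> G n" if "n \<ge> 1" for n
    using real that unfolding \<Phi>_def E_def by (simp_all add: awcga_realization_def)
  have \<phi>X: "\<phi> ` {1..n} \<subseteq> carrier X" for n using \<phi>D DX by auto
  note V = lin_span_closed[OF \<phi>X, folded \<Phi>_def]
  have Vmono: "\<Phi> i \<subseteq> \<Phi> j" if "i \<le> j" for i j
    unfolding \<Phi>_def using that by (intro lin_span_mono) auto
  have E0: "0 \<le> E n" for n unfolding E_def by (rule best_approx_error_nonneg[OF f V(1)]) (use V(2) in blast)
  have Eanti: "E j \<le> E i" if "i \<le> j" for i j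
    unfolding E_def by (rule best_approx_error_antimono[OF f Vmono[OF that] V(1)]) (use V(2) in blast)
  have Ef: "E n \<le> nrm X f" for n
    using best_approx_error_le[OF f V(1) V(2)[of n]] f by (simp add: E_def minus_conv)
  obtain H where H: "0 \<le> H" "\<And>n. n \<ge> 1 \<Longrightarrow> \<eta> n \<le> H"
  proof -
    from bd obtain H where "\<And>n. n \<ge> 1 \<Longrightarrow> \<bar>\<eta> n\<bar> \<le> H" by (auto simp: bounded_iff)
    from this[of 1] this that[of H] show thesis by force
  qed
  have \<eta>0: "0 \<le> \<eta> n" if "n \<ge> 1" for n using \<eta> that by (simp add: error_seq_def)
  have \<delta>0: "0 \<le> \<delta> n" "\<delta> n \<le> 1" for n using \<delta> by (auto simp: perturbation_seq_def)
  have rH: "nrm X (r n) \<le> (1 + H) * E n" if "n \<ge> 1" for n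
    using near[OF that] mult_right_mono[OF H(2)[OF that] E0[of n]] by (simp add: algebra_simps)
  show "(\<lambda>n. nrm X (r n)) \<longlonglongrightarrow> 0"
  proof (cases "\<exists>e>0. \<forall>n. e \<le> E n")
    case False
    have "E \<longlonglongrightarrow> 0"
    proof (rule order_tendstoI)
      fix a :: real assume "0 < a"
      with False obtain m where "E m < a" by (auto simp: not_le)
      then have "E n < a" if "n \<ge> m" for n using Eanti[OF that] by simp
      then show "\<forall>\<^sub>F n in sequentially. E n < a" by (auto simp: eventually_sequentially)
    next
      fix a :: real assume "a < 0"
      then show "\<forall>\<^sub>F n in sequentially. a < E n" using less_le_trans[OF _ E0] by (intro always_eventually allI) blast
    qed
    then have "(\<lambda>n. (1 + H) * E n) \<longlonglongrightarrow> 0" by (rule tendsto_mult_right_zero)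
    moreover have "\<forall>\<^sub>F n in sequentially. norm (nrm X (r n)) \<le> (1 + H) * E n"
      using eventually_ge_at_top[of 1]
    proof eventually_elim
      case (elim n)
      have "r n \<in> carrier X" using r[OF elim] f GV[OF elim] V(1) by auto
      with rH[OF elim] show ?case by simp
    qed
    ultimately show ?thesis by (rule Lim_null_comparison[rotated])
  next
    case True
    then obtain e where e: "0 < e" "\<And>n. e \<le> E n" by auto
    define s where "s k = t (n k + 1) powr p" for k
    define \<rho> where "\<rho> k = \<delta> (n k) + 2 * \<eta> (n k)" for k
    have t01: "0 \<le> t (n k + 1)" "t (n k + 1) \<le> 1" for k using t by (auto simp: weakness_seq_def)
    have p: "0 < p" using q by simp
    have s01: "0 \<le> s k" "s k \<le> 1" for k
      using t01[of k] p powr_mono2[of p "t (n k + 1)" 1] by (auto simp: s_def)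
    have fpos: "0 < nrm X f" using e(1) e(2)[of 0] Ef[of 0] by linarith
    \<comment> \<open>As \<open>s k \<le> 1\<close>, this also says that \<open>\<rho> k\<close> tends to 0.\<close>
    have small: "\<forall>\<^sub>F k in sequentially. \<rho> k * nrm X f \<le> c * s k" if "0 < c" for c
    proof -
      let ?c = "c / (3 * nrm X f)"
      have "0 < ?c" using that fpos by simp
      from nonneg_little_oD[OF od[folded s_def] s01(1) this] nonneg_little_oD[OF oe[folded s_def] s01(1) this]
      show ?thesis
      proof eventually_elim
        case (elim k)
        then have "\<rho> k \<le> 3 * ?c * s k" by (simp add: \<rho>_def)
        from mult_right_mono[OF this, of "nrm X f"] fpos show ?case by simp
      qed
    qed
    have descent: "nrm X (f \<ominus>\<^bsub>X\<^esub> (G (n k) \<oplus>\<^bsub>X\<^esub> y))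
        \<le> E (n k) + \<rho> k * nrm X f - F (n k) y + 2 * \<gamma> * nrm X y powr q * e powr (1 - q)"
      if y: "y \<in> carrier X" for k y
    proof -
      note * = greedy_descent[OF \<gamma>(2) _ q(1) F(1,2)[of "n k"] f V(1) GV[OF n(2)] \<delta>0 \<eta>0[OF n(2)] e(1),
          folded E_def, folded r[OF n(2)], OF _ e(2) near[OF n(2)] Fr y]
      have "\<rho> k * E (n k) \<le> \<rho> k * nrm X f"
        using \<delta>0(1)[of "n k"] \<eta>0[OF n(2)[of k]] Ef by (intro mult_left_mono) (auto simp: \<rho>_def)
      with * \<gamma>(1) show ?thesis by (simp add: \<rho>_def algebra_simps)
    qed
    define M where "M = (2 + H) * nrm X f"
    have GM: "nrm X (G n) \<le> M" if "n \<ge> 1" for n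
    proof -
      have G: "G n \<in> carrier X" using GV[OF that] V(1) by auto
      have "G n = f \<ominus>\<^bsub>X\<^esub> r n"
        using f G by (simp add: r[OF that] minus_conv smult_add smult_smult) (metis M.a_assoc M.add.inv_closed M.l_zero M.r_neg neg_smult)
      then have "nrm X (G n) \<le> nrm X f + nrm X (r n)" using nrm_minus_le[of f "r n"] f r[OF that] G by simp
      moreover have "nrm X (r n) \<le> (1 + H) * nrm X f"
        using rH[OF that] mult_left_mono[OF Ef[of n], of "1 + H"] H(1) by linarith
      ultimately show ?thesis by (simp add: M_def algebra_simps)
    qed
    have Mpos: "0 < M" using fpos H by (simp add: M_def)
    obtain \<tau> where \<tau>: "0 < \<tau>" "2 * \<gamma> * M powr q * e powr (1 - q) * \<tau> powr q \<le> e / 4 * \<tau>"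
      using ex_small_step[of "2 * \<gamma> * M powr q * e powr (1 - q)" "e / 4" q] \<gamma> e q by auto
    have \<tau>e: "0 < \<tau> * e / 8" using \<tau>(1) e(1) by simp
    \<comment> \<open>Only a lower bound matters, so the descent inequality is applied to a negative multiple of \<open>G\<close>.\<close>
    have orth: "\<forall>\<^sub>F k in sequentially. - (3 * e / 8) \<le> F (n k) (G (n k))"
      using small[OF \<tau>e]
    proof eventually_elim
      case (elim k)
      let ?G = "G (n k)" and ?y = "(- \<tau>) \<odot>\<^bsub>X\<^esub> G (n k)"
      have G: "?G \<in> \<Phi> (n k)" "?G \<in> carrier X" using GV[OF n(2)] V(1) by auto
      have "?G \<oplus>\<^bsub>X\<^esub> ?y \<in> \<Phi> (n k)" using V(3,4) G by blast
      then have "E (n k) \<le> nrm X (f \<ominus>\<^bsub>X\<^esub> (?G \<oplus>\<^bsub>X\<^esub> ?y))"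
        unfolding E_def by (intro best_approx_error_le[OF f V(1)])
      also have "\<dots> \<le> E (n k) + \<rho> k * nrm X f - F (n k) ?y + 2 * \<gamma> * nrm X ?y powr q * e powr (1 - q)"
        by (rule descent) (use G in auto)
      also have "F (n k) ?y = - \<tau> * F (n k) ?G"
        using F(1)[of "n k"] G by (simp add: bounded_linear_functional_def linear_functional_def)
      finally have 1: "- \<tau> * F (n k) ?G \<le> \<rho> k * nrm X f + 2 * \<gamma> * nrm X ?y powr q * e powr (1 - q)" by simp
      have "nrm X ?y powr q \<le> (\<tau> * M) powr q"
        using G \<tau>(1) GM[OF n(2), of k] q by (intro powr_mono2) (auto simp: nrm_smult intro: mult_left_mono)
      also have "\<dots> = \<tau> powr q * M powr q" using \<tau>(1) Mpos by (simp add: powr_mult)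
      finally have "nrm X ?y powr q \<le> \<tau> powr q * M powr q" .
      then have "2 * \<gamma> * e powr (1 - q) * nrm X ?y powr q \<le> 2 * \<gamma> * e powr (1 - q) * (\<tau> powr q * M powr q)"
        using \<gamma>(1) by (intro mult_left_mono) auto
      then have 2: "2 * \<gamma> * nrm X ?y powr q * e powr (1 - q) \<le> e / 4 * \<tau>"
        using \<tau>(2) by (simp add: mult_ac)
      have "\<tau> * e / 8 * s k \<le> \<tau> * e / 8 * 1"
        using s01[of k] \<tau>(1) e(1) by (intro mult_left_mono) auto
      with 1 2 elim have "\<tau> * (- F (n k) ?G) \<le> \<tau> * (3 * e / 8)" by (simp add: algebra_simps)
      then show ?case using \<tau>(1) by (simp only: mult_le_cancel_left_pos)
    qed
    obtain v where v: "v \<in> lin_span X D" "nrm X (f \<ominus>\<^bsub>X\<^esub> v) < e / 8"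
    proof -
      interpret MS: Metric_space "carrier X" "ndist X" by (rule Metric_space_ndist[OF norm])
      have "f \<in> MS.mtopology closure_of lin_span X D" using D f by (simp add: dictionary_def)
      then obtain v where "v \<in> lin_span X D" "v \<in> MS.mball f (e / 8)"
        unfolding MS.metric_closure_of using e(1) by (smt (verit) mem_Collect_eq divide_pos_pos)
      then show thesis using that[of v] f by (auto simp: ndist_def)
    qed
    have vX: "v \<in> carrier X" using v(1) lin_span_closed(1)[OF DX] by auto
    have "D \<noteq> {}" using \<phi>D[of 1] by auto
    from dictionary_sup_dominates_span[OF D this v(1)] obtain A
      where A0: "0 \<le> A" and "\<forall>F. bounded_linear_functional X F \<longrightarrow> functional_norm X F \<le> 1 \<longrightarrow> \<bar>F v\<bar> \<le> A * (SUP g\<in>D. F g)"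
      by (elim exE conjE)
    then have A: "\<bar>F k v\<bar> \<le> A * (SUP g\<in>D. F k g)" for k using F[of k] by simp
    have f8: "0 < nrm X f / 8" using fpos by simp
    have Flow: "\<forall>\<^sub>F k in sequentially. 3 * e / 8 \<le> F (n k) v"
      using orth small[OF f8]
    proof eventually_elim
      case (elim k)
      have "\<rho> k * nrm X f \<le> 1 / 8 * nrm X f"
        using elim(2) s01(2)[of k] mult_left_mono[of "s k" 1 "nrm X f / 8"] fpos by simp
      then have "\<rho> k \<le> 1 / 8" using fpos by (simp only: mult_le_cancel_right_pos)
      then have d: "\<delta> (n k) \<le> 1 / 8" using \<eta>0[OF n(2)[of k]] by (simp add: \<rho>_def)
      have G: "G (n k) \<in> carrier X" using GV[OF n(2)] V(1) by auto
      have lin: "linear_functional X (F (n k))" using F(1) by (simp add: bounded_linear_functional_def)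
      have er: "e \<le> nrm X (r (n k))"
        using best_approx_error_le[OF f V(1) GV[OF n(2)]] e(2)[of "n k"] r[OF n(2)] unfolding E_def by (metis order_trans)
      have "7 / 8 * e \<le> (1 - \<delta> (n k)) * nrm X (r (n k))"
        using er d e(1) by (intro mult_mono) auto
      also note Fr[of "n k"]
      also have "F (n k) (r (n k)) = F (n k) f - F (n k) (G (n k))"
        unfolding r[OF n(2)] by (rule functional_minus[OF lin f G])
      finally have "7 / 8 * e + F (n k) (G (n k)) \<le> F (n k) f" by simp
      moreover have "F (n k) f - F (n k) v \<le> e / 8"
        using functional_le_norm[OF F[of "n k"], of "f \<ominus>\<^bsub>X\<^esub> v"] functional_minus[OF lin f vX] v(2) f vX by simp
      ultimately show ?case using elim(1) by simp
    qed
    have Apos: "0 < A"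
    proof -
      from Flow obtain k where "3 * e / 8 \<le> F (n k) v" by (auto simp: eventually_sequentially)
      with A[of "n k"] e(1) have "A \<noteq> 0" by (intro notI) simp
      with A0 show ?thesis by simp
    qed
    define c where "c = 3 * e / (8 * A)"
    have c: "0 < c" using e(1) Apos by (simp add: c_def)
    have Slow: "\<forall>\<^sub>F k in sequentially. c \<le> (SUP g\<in>D. F (n k) g)"
      using Flow
    proof eventually_elim
      case (elim k)
      with A[of "n k"] have "3 * e / 8 \<le> A * (SUP g\<in>D. F (n k) g)" by simp
      then show ?case using Apos by (simp add: c_def field_simps)
    qed
    obtain \<mu> where \<mu>: "0 < \<mu>" "2 * \<gamma> * e powr (1 - q) * \<mu> powr q \<le> c / 2 * \<mu>"
      using ex_small_step[of "2 * \<gamma> * e powr (1 - q)" "c / 2" q] \<gamma> c q by auto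
    define \<kappa> where "\<kappa> = \<mu> * c / 4"
    have \<kappa>: "0 < \<kappa>" using \<mu>(1) c by (simp add: \<kappa>_def)
    have desc: "\<forall>\<^sub>F k in sequentially. E (n k + 1) \<le> E (n k) - \<kappa> * s k"
      using Slow small[OF \<kappa>]
    proof eventually_elim
      case (elim k)
      let ?t = "t (n k + 1)"
      \<comment> \<open>This step length balances gain and loss: both become multiples of \<open>t powr p\<close>.\<close>
      define l where "l = \<mu> * ?t powr (1 / (q - 1))"
      have l0: "0 \<le> l" using \<mu>(1) by (simp add: l_def)
      have p_eq: "1 + 1 / (q - 1) = p" "1 / (q - 1) * q = p" using q by (auto simp: field_simps)
      have lt: "l * ?t = \<mu> * s k"
        using powr_mult_base[OF t01(1)[of k], of "1 / (q - 1)"] p_eq by (simp add: l_def s_def mult_ac)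
      have lq: "l powr q = \<mu> powr q * s k"
        using \<mu>(1) p_eq(2) by (simp add: l_def s_def powr_mult powr_powr)
      let ?g = "\<phi> (n k + 1)" and ?y = "l \<odot>\<^bsub>X\<^esub> \<phi> (n k + 1)"
      have g: "?g \<in> carrier X" "nrm X ?g = 1" using \<phi>D[of "n k + 1"] DX D1 by auto
      have "?g \<in> \<Phi> (n k + 1)" unfolding \<Phi>_def by (rule subsetD[OF lin_span_superset]) auto
      moreover have "G (n k) \<in> \<Phi> (n k + 1)" using GV[OF n(2)] Vmono[of "n k" "n k + 1"] by auto
      ultimately have "G (n k) \<oplus>\<^bsub>X\<^esub> ?y \<in> \<Phi> (n k + 1)" using V(3,4) by blast
      then have "E (n k + 1) \<le> nrm X (f \<ominus>\<^bsub>X\<^esub> (G (n k) \<oplus>\<^bsub>X\<^esub> ?y))"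
        unfolding E_def by (intro best_approx_error_le[OF f V(1)])
      also have "\<dots> \<le> E (n k) + \<rho> k * nrm X f - F (n k) ?y + 2 * \<gamma> * nrm X ?y powr q * e powr (1 - q)"
        by (rule descent) (use g in auto)
      also have "nrm X ?y = l" using g l0 by (simp add: nrm_smult)
      also have "2 * \<gamma> * l powr q * e powr (1 - q) \<le> c / 2 * \<mu> * s k"
        using mult_right_mono[OF \<mu>(2) s01(1)[of k]] by (simp add: lq mult_ac)
      also have "F (n k) ?y = l * F (n k) ?g"
        using F(1)[of "n k"] g by (simp add: bounded_linear_functional_def linear_functional_def)
      finally have 1: "E (n k + 1) \<le> E (n k) + \<rho> k * nrm X f - l * F (n k) ?g + c / 2 * \<mu> * s k" by simp
      have "?t * c \<le> ?t * (SUP g\<in>D. F (n k) g)" using elim(1) t01(1) by (rule mult_left_mono)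
      also have "\<dots> \<le> F (n k) ?g" using F\<phi>[of "n k"] by simp
      finally have "l * (?t * c) \<le> l * F (n k) ?g" using l0 by (rule mult_left_mono)
      then have "c * \<mu> * s k \<le> l * F (n k) ?g" using lt by (simp add: mult_ac)
      with 1 elim(2) show ?case by (simp add: \<kappa>_def algebra_simps)
    qed
    have "\<not> filterlim (\<lambda>K. \<Sum>k<K. s k) at_top sequentially"
      by (rule bounded_sums_of_descent[OF n(1) Eanti E0 \<kappa> desc])
    with div show ?thesis by (simp add: s_def)
  qed
qed

section \<open>Power-type spaces of sequences\<close>

text \<open>
Convexity of the power on the closed half line; at the endpoint 0 it amounts to \<open>w powr q \<le> w\<close> for
\<open>0 \<le> w \<le> 1\<close>.
\<close>

lemma powr_convex_comb:
  fixes a b u v q :: real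
  assumes "1 \<le> q" "0 \<le> a" "0 \<le> b" "0 \<le> u" "0 \<le> v" "u + v = 1"
  shows "(u * a + v * b) powr q \<le> u * a powr q + v * b powr q"
proof -
  have zero: "(w * c) powr q \<le> w * c powr q" if "0 \<le> w" "w \<le> 1" "0 \<le> c" for w c :: real
  proof -
    have "w powr q \<le> w"
      using that assms powr_mono'[of 1 q w] by simp
    then show ?thesis using that by (simp add: powr_mult mult_right_mono)
  qed
  consider "a = 0" | "b = 0" | "0 < a" "0 < b" using assms by linarith
  then show ?thesis
  proof cases
    case 1 then show ?thesis using zero[of v b] assms by simp
  next
    case 2 then show ?thesis using zero[of u a] assms by simp
  next
    case 3
    then show ?thesis
      using powr_convex[OF assms(1)] assms unfolding convex_on_def by auto
  qed
qed

lemma powr_superadditive: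
  fixes a b r :: real
  assumes "1 \<le> r" "0 \<le> a" "0 \<le> b"
  shows "a powr r + b powr r \<le> (a + b) powr r"
proof -
  have "c powr r \<le> c * (a + b) powr (r - 1)" if "0 \<le> c" "c \<le> a + b" for c
    using that assms powr_mult_base[of c "r - 1"] mult_left_mono[OF powr_mono2[of "r - 1" c "a + b"], of c] by simp
  from this[of a] this[of b] have "a powr r + b powr r \<le> (a + b) * (a + b) powr (r - 1)"
    using assms by (simp add: distrib_right)
  also have "\<dots> = (a + b) powr r" using powr_mult_base[of "a + b" "r - 1"] assms by simp
  finally show ?thesis .
qed

text \<open>
After raising both sides to the power \<open>2 / q \<ge> 1\<close>, convexity bounds the left side by
\<open>((a + b)\<^sup>2 + (a - b)\<^sup>2) / 2 = a\<^sup>2 + b\<^sup>2\<close> and superadditivity bounds the right side below by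
the same value.
\<close>

lemma parallelogram_powr_inequality:
  fixes a b q :: real
  assumes "1 \<le> q" "q \<le> 2"
  shows "(\<bar>a + b\<bar> powr q + \<bar>a - b\<bar> powr q) / 2 \<le> \<bar>a\<bar> powr q + \<bar>b\<bar> powr q"
proof -
  let ?r = "2 / q"
  have r: "1 \<le> ?r" using assms by simp
  have sq: "(\<bar>c\<bar> powr q) powr ?r = c\<^sup>2" for c
    using assms by (cases "c = 0") (simp_all add: powr_powr powr_numeral)
  let ?X = "\<bar>a + b\<bar> powr q" and ?Y = "\<bar>a - b\<bar> powr q"
  have "((?X + ?Y) / 2) powr ?r \<le> ((a + b)\<^sup>2 + (a - b)\<^sup>2) / 2"
    using powr_convex_comb[OF r, of ?X ?Y "1/2" "1/2"] by (simp add: sq add_divide_distrib)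
  also have "\<dots> = a\<^sup>2 + b\<^sup>2" by (simp add: power2_eq_square algebra_simps)
  also have "\<dots> \<le> (\<bar>a\<bar> powr q + \<bar>b\<bar> powr q) powr ?r"
    using powr_superadditive[OF r, of "\<bar>a\<bar> powr q" "\<bar>b\<bar> powr q"] by (simp add: sq)
  finally have *: "((?X + ?Y) / 2) powr ?r \<le> (\<bar>a\<bar> powr q + \<bar>b\<bar> powr q) powr ?r" .
  show ?thesis
  proof (rule ccontr)
    assume "\<not> ?thesis"
    then have "(\<bar>a\<bar> powr q + \<bar>b\<bar> powr q) powr ?r < ((?X + ?Y) / 2) powr ?r"
      using assms by (intro powr_less_mono2) (auto simp: not_le)
    with * show False by simp
  qed
qed

definition lq :: "real \<Rightarrow> (nat \<Rightarrow> real) set" where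
  "lq q = {x. summable (\<lambda>i. \<bar>x i\<bar> powr q)}"

definition lqsum :: "real \<Rightarrow> (nat \<Rightarrow> real) \<Rightarrow> real" where
  "lqsum q x = (\<Sum>i. \<bar>x i\<bar> powr q)"

definition lqnorm :: "real \<Rightarrow> (nat \<Rightarrow> real) \<Rightarrow> real" where
  "lqnorm q x = lqsum q x powr (1 / q)"

lemma lqsum_nonneg: "x \<in> lq q \<Longrightarrow> 0 \<le> lqsum q x"
  by (simp add: lq_def lqsum_def suminf_nonneg)

lemma lqnorm_nonneg [simp]: "0 \<le> lqnorm q x"
  by (simp add: lqnorm_def)

lemma lqnorm_powr: "0 < q \<Longrightarrow> x \<in> lq q \<Longrightarrow> lqnorm q x powr q = lqsum q x"
  using lqsum_nonneg[of x q] by (simp add: lqnorm_def powr_powr)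

lemma lqnorm_le: "0 < q \<Longrightarrow> x \<in> lq q \<Longrightarrow> 0 \<le> A \<Longrightarrow> lqsum q x \<le> A powr q \<Longrightarrow> lqnorm q x \<le> A"
  using powr_mono2[of "1/q" "lqsum q x" "A powr q"] lqsum_nonneg[of x q]
  by (simp add: lqnorm_def powr_powr)

lemma lqsum_le: "0 < q \<Longrightarrow> x \<in> lq q \<Longrightarrow> lqnorm q x \<le> A \<Longrightarrow> lqsum q x \<le> A powr q"
  using powr_mono2[of q "lqnorm q x" A] by (simp add: lqnorm_powr)

lemma lqI_dominated:
  assumes "\<And>i. \<bar>x i\<bar> powr q \<le> b i" "summable b"
  shows "x \<in> lq q" "lqsum q x \<le> suminf b"
proof -
  have s: "summable (\<lambda>i. \<bar>x i\<bar> powr q)"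
    by (rule summable_comparison_test[OF _ assms(2)]) (use assms(1) in auto)
  then show "x \<in> lq q" by (simp add: lq_def)
  show "lqsum q x \<le> suminf b" unfolding lqsum_def by (rule suminf_le[OF assms(1) s assms(2)])
qed

lemma lq_coord_le:
  assumes "0 < q" "x \<in> lq q"
  shows "\<bar>x i\<bar> \<le> lqnorm q x"
proof -
  have "\<bar>x i\<bar> powr q = (\<Sum>j\<in>{i}. \<bar>x j\<bar> powr q)" by simp
  also have "\<dots> \<le> lqsum q x"
    using assms unfolding lq_def lqsum_def by (intro sum_le_suminf) auto
  finally have "(\<bar>x i\<bar> powr q) powr (1 / q) \<le> lqnorm q x"
    unfolding lqnorm_def using assms by (intro powr_mono2) auto
  then show ?thesis using assms by (simp add: powr_powr)
qed

lemma lq_zero: "(\<lambda>i. 0) \<in> lq q" "lqnorm q (\<lambda>i. 0) = 0"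
  by (simp_all add: lq_def lqnorm_def lqsum_def)

lemma lqnorm_eq_0: "0 < q \<Longrightarrow> x \<in> lq q \<Longrightarrow> lqnorm q x = 0 \<longleftrightarrow> x = (\<lambda>i. 0)"
  using lq_coord_le[of q x] by (auto simp: lq_zero)

lemma lq_scale:
  assumes "0 < q" "x \<in> lq q"
  shows "(\<lambda>i. a * x i) \<in> lq q" "lqnorm q (\<lambda>i. a * x i) = \<bar>a\<bar> * lqnorm q x"
proof -
  have e: "\<bar>a * x i\<bar> powr q = \<bar>a\<bar> powr q * \<bar>x i\<bar> powr q" for i by (simp add: abs_mult powr_mult)
  show "(\<lambda>i. a * x i) \<in> lq q" using assms unfolding lq_def by (simp add: e summable_mult)
  have "lqsum q (\<lambda>i. a * x i) = \<bar>a\<bar> powr q * lqsum q x"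
    using assms unfolding lqsum_def e lq_def by (simp add: suminf_mult)
  then show "lqnorm q (\<lambda>i. a * x i) = \<bar>a\<bar> * lqnorm q x"
    using assms lqsum_nonneg[of x q] by (simp add: lqnorm_def powr_mult powr_powr)
qed

text \<open>
Minkowski's inequality by convexity.  Upper bounds \<open>A\<close>, \<open>B\<close> in place of the norms keep the
denominators positive, also for the zero sequence.
\<close>

lemma lq_add_bound:
  assumes q: "1 \<le> q" and xy: "x \<in> lq q" "y \<in> lq q" and A: "0 < A" "0 < B"
    and b: "lqnorm q x \<le> A" "lqnorm q y \<le> B"
  shows "(\<lambda>i. x i + y i) \<in> lq q" "lqnorm q (\<lambda>i. x i + y i) \<le> A + B"
proof -
  define u v where "u = A / (A + B)" and "v = B / (A + B)"
  define b where "b i = (A + B) powr q * (u * (\<bar>x i\<bar> powr q / A powr q) + v * (\<bar>y i\<bar> powr q / B powr q))" for i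
  have uv: "0 \<le> u" "0 \<le> v" "u + v = 1" using A by (simp_all add: u_def v_def add_divide_distrib[symmetric])
  have dom: "\<bar>x i + y i\<bar> powr q \<le> b i" for i
  proof -
    have "\<bar>x i + y i\<bar> \<le> (A + B) * (u * (\<bar>x i\<bar> / A) + v * (\<bar>y i\<bar> / B))"
    proof -
      have "(A + B) * (u * (\<bar>x i\<bar> / A) + v * (\<bar>y i\<bar> / B)) = \<bar>x i\<bar> + \<bar>y i\<bar>"
        using A by (simp add: u_def v_def distrib_left)
      then show ?thesis by simp
    qed
    then have "\<bar>x i + y i\<bar> powr q \<le> ((A + B) * (u * (\<bar>x i\<bar> / A) + v * (\<bar>y i\<bar> / B))) powr q"
      using q by (intro powr_mono2) auto
    also have "\<dots> = (A + B) powr q * (u * (\<bar>x i\<bar> / A) + v * (\<bar>y i\<bar> / B)) powr q"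
      using A uv by (simp add: powr_mult)
    also have "\<dots> \<le> (A + B) powr q * (u * (\<bar>x i\<bar> / A) powr q + v * (\<bar>y i\<bar> / B) powr q)"
      using A uv q by (intro mult_left_mono powr_convex_comb) auto
    also have "\<dots> = b i" using A by (simp add: b_def powr_divide)
    finally show ?thesis .
  qed
  have sx: "(\<lambda>i. \<bar>x i\<bar> powr q) sums lqsum q x" and sy: "(\<lambda>i. \<bar>y i\<bar> powr q) sums lqsum q y"
    using xy by (auto simp: lq_def lqsum_def)
  have bs: "b sums ((A + B) powr q * (u * (lqsum q x / A powr q) + v * (lqsum q y / B powr q)))"
    unfolding b_def by (intro sums_mult sums_add sums_divide sx sy)
  have "lqsum q x / A powr q \<le> 1" "lqsum q y / B powr q \<le> 1"
    using lqsum_le[OF _ xy(1) b(1)] lqsum_le[OF _ xy(2) b(2)] q A by (simp_all add: divide_le_eq_1_pos)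
  then have "u * (lqsum q x / A powr q) + v * (lqsum q y / B powr q) \<le> u * 1 + v * 1"
    using uv by (intro add_mono mult_left_mono) auto
  then have "suminf b \<le> (A + B) powr q * 1"
    unfolding sums_unique[OF bs, symmetric] using uv by (intro mult_left_mono) auto
  moreover note d = lqI_dominated[OF dom sums_summable[OF bs]]
  ultimately show "(\<lambda>i. x i + y i) \<in> lq q" "lqnorm q (\<lambda>i. x i + y i) \<le> A + B"
    using q A by (auto intro!: lqnorm_le)
qed

lemma lq_add:
  assumes "1 \<le> q" "x \<in> lq q" "y \<in> lq q"
  shows "(\<lambda>i. x i + y i) \<in> lq q"
  by (rule lq_add_bound(1)[OF assms, of "lqnorm q x + 1" "lqnorm q y + 1"])
    (auto simp: add_nonneg_pos)

lemma lqnorm_triangle: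
  assumes "1 \<le> q" "x \<in> lq q" "y \<in> lq q"
  shows "lqnorm q (\<lambda>i. x i + y i) \<le> lqnorm q x + lqnorm q y"
proof (rule field_le_epsilon)
  fix e :: real assume "0 < e"
  then show "lqnorm q (\<lambda>i. x i + y i) \<le> lqnorm q x + lqnorm q y + e"
    using lq_add_bound(2)[OF assms, of "lqnorm q x + e / 2" "lqnorm q y + e / 2"]
    by (simp add: add_nonneg_pos)
qed

lemma lq_diff:
  assumes "1 \<le> q" "x \<in> lq q" "y \<in> lq q"
  shows "(\<lambda>i. x i - y i) \<in> lq q"
  using lq_add[OF assms(1,2) lq_scale(1)[OF _ assms(3), of "-1"]] assms(1) by simp

text \<open>
This is why $\ell_q$ has power type \<open>q\<close>: for unit vectors \<open>x\<close>, \<open>y\<close> the mean of \<open>\<parallel>x + u y\<parallel>\<close> and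
\<open>\<parallel>x - u y\<parallel>\<close> is at most \<open>(1 + u\<^sup>q) powr (1 / q) \<le> 1 + u\<^sup>q\<close>.
\<close>

lemma lq_smoothness:
  assumes q: "1 \<le> q" "q \<le> 2" and xy: "x \<in> lq q" "y \<in> lq q"
  shows "((lqnorm q (\<lambda>i. x i + y i) + lqnorm q (\<lambda>i. x i - y i)) / 2) powr q \<le> lqsum q x + lqsum q y"
proof -
  note a = lq_add[OF q(1) xy] and d = lq_diff[OF q(1) xy]
  have "((lqnorm q (\<lambda>i. x i + y i) + lqnorm q (\<lambda>i. x i - y i)) / 2) powr q
    \<le> (lqsum q (\<lambda>i. x i + y i) + lqsum q (\<lambda>i. x i - y i)) / 2"
    using powr_convex_comb[OF q(1), of "lqnorm q (\<lambda>i. x i + y i)" "lqnorm q (\<lambda>i. x i - y i)" "1/2" "1/2"]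
      lqnorm_powr[OF _ a] lqnorm_powr[OF _ d] q by (simp add: add_divide_distrib)
  also have "\<dots> \<le> lqsum q x + lqsum q y"
  proof -
    have "(\<lambda>i. (\<bar>x i + y i\<bar> powr q + \<bar>x i - y i\<bar> powr q) / 2) sums
        ((lqsum q (\<lambda>i. x i + y i) + lqsum q (\<lambda>i. x i - y i)) / 2)"
      using a d unfolding lq_def lqsum_def by (intro sums_divide sums_add summable_sums) auto
    moreover have "(\<lambda>i. \<bar>x i\<bar> powr q + \<bar>y i\<bar> powr q) sums (lqsum q x + lqsum q y)"
      using xy unfolding lq_def lqsum_def by (intro sums_add summable_sums) auto
    ultimately show ?thesis using parallelogram_powr_inequality[OF q] by (rule sums_le[rotated 1])
  qed
  finally show ?thesis .
qed

text \<open>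
The coordinatewise limit is the limit in norm, because a bound on all finite partial sums survives
a coordinatewise limit.
\<close>

lemma lq_complete:
  fixes \<sigma> :: "nat \<Rightarrow> nat \<Rightarrow> real"
  assumes q: "1 \<le> q" and \<sigma>: "\<And>n. \<sigma> n \<in> lq q"
    and cau: "\<And>e. 0 < e \<Longrightarrow> \<exists>N. \<forall>n\<ge>N. \<forall>m\<ge>N. lqnorm q (\<lambda>i. \<sigma> n i - \<sigma> m i) < e"
  shows "\<exists>y\<in>lq q. \<forall>e>0. \<exists>N. \<forall>n\<ge>N. lqnorm q (\<lambda>i. \<sigma> n i - y i) \<le> e"
proof -
  have d: "(\<lambda>i. \<sigma> n i - \<sigma> m i) \<in> lq q" for n m using \<sigma> by (intro lq_diff q)
  have "convergent (\<lambda>n. \<sigma> n i)" for i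
  proof -
    have "Cauchy (\<lambda>n. \<sigma> n i)"
    proof (rule metric_CauchyI)
      fix e :: real assume "0 < e"
      from cau[OF this] obtain N where N: "\<forall>n\<ge>N. \<forall>m\<ge>N. lqnorm q (\<lambda>i. \<sigma> n i - \<sigma> m i) < e" ..
      show "\<exists>M. \<forall>m\<ge>M. \<forall>n\<ge>M. dist (\<sigma> m i) (\<sigma> n i) < e"
      proof (intro exI allI impI)
        fix m n assume "m \<ge> N" "n \<ge> N"
        with N lq_coord_le[OF _ d[of m n], of i] q show "dist (\<sigma> m i) (\<sigma> n i) < e"
          by (auto simp: dist_real_def intro: le_less_trans)
      qed
    qed
    then show ?thesis by (rule Cauchy_convergent)
  qed
  then obtain y where y: "\<And>i. (\<lambda>n. \<sigma> n i) \<longlonglongrightarrow> y i" unfolding convergent_def by metis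
  have close: "(\<lambda>i. \<sigma> n i - y i) \<in> lq q \<and> lqnorm q (\<lambda>i. \<sigma> n i - y i) \<le> e"
    if e: "0 < e" and N: "\<forall>n\<ge>N. \<forall>m\<ge>N. lqnorm q (\<lambda>i. \<sigma> n i - \<sigma> m i) < e" and n: "n \<ge> N" for e N n
  proof -
    have part: "(\<Sum>i<K. \<bar>\<sigma> n i - y i\<bar> powr q) \<le> e powr q" for K
    proof (rule tendsto_upperbound)
      show "(\<lambda>m. \<Sum>i<K. \<bar>\<sigma> n i - \<sigma> m i\<bar> powr q) \<longlonglongrightarrow> (\<Sum>i<K. \<bar>\<sigma> n i - y i\<bar> powr q)"
        using q by (intro tendsto_sum tendsto_powr' tendsto_rabs tendsto_diff tendsto_const y) auto
      show "\<forall>\<^sub>F m in sequentially. (\<Sum>i<K. \<bar>\<sigma> n i - \<sigma> m i\<bar> powr q) \<le> e powr q"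
        using eventually_ge_at_top[of N]
      proof eventually_elim
        case (elim m)
        have "(\<Sum>i<K. \<bar>\<sigma> n i - \<sigma> m i\<bar> powr q) \<le> lqsum q (\<lambda>i. \<sigma> n i - \<sigma> m i)"
          using d[of n m] unfolding lq_def lqsum_def by (intro sum_le_suminf) auto
        also have "\<dots> \<le> e powr q" using N n elim q by (intro lqsum_le d less_imp_le) auto
        finally show ?case .
      qed
    qed simp
    have s: "summable (\<lambda>i. \<bar>\<sigma> n i - y i\<bar> powr q)"
      by (rule summableI_nonneg_bounded[OF _ part]) simp
    then have "lqsum q (\<lambda>i. \<sigma> n i - y i) \<le> e powr q" unfolding lqsum_def by (intro suminf_le_const part)
    with s e q show ?thesis by (auto intro!: lqnorm_le simp: lq_def)
  qed
  obtain N where "\<forall>n\<ge>N. \<forall>m\<ge>N. lqnorm q (\<lambda>i. \<sigma> n i - \<sigma> m i) < 1" using cau[of 1] by auto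
  from close[OF _ this, of N] have "(\<lambda>i. \<sigma> N i - y i) \<in> lq q" by simp
  from lq_diff[OF q \<sigma>[of N] this] have "y \<in> lq q" by simp
  moreover have "\<exists>N. \<forall>n\<ge>N. lqnorm q (\<lambda>i. \<sigma> n i - y i) \<le> e" if "0 < e" for e
    using cau[OF that] close[OF that] by blast
  ultimately show ?thesis by blast
qed

lemma lq_tail_small:
  assumes q: "1 \<le> q" and x: "x \<in> lq q" and e: "0 < e"
  shows "\<exists>K. (\<lambda>i. if i < K then 0 else x i) \<in> lq q \<and> lqnorm q (\<lambda>i. if i < K then 0 else x i) < e"
proof -
  have s: "summable (\<lambda>i. \<bar>x i\<bar> powr q)" using x by (simp add: lq_def)
  from suminf_exist_split[OF _ s, of "(e / 2) powr q"] e obtain K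
    where K: "norm (\<Sum>i. \<bar>x (i + K)\<bar> powr q) < (e / 2) powr q" by auto
  let ?y = "\<lambda>i. if i < K then 0 else x i"
  have y: "?y \<in> lq q" by (rule lqI_dominated(1)[OF _ s]) auto
  have "lqsum q ?y = (\<Sum>i. \<bar>x (i + K)\<bar> powr q)"
    using suminf_split_initial_segment[of "\<lambda>i. \<bar>?y i\<bar> powr q" K] y by (simp add: lq_def lqsum_def)
  with K have "lqsum q ?y \<le> (e / 2) powr q" by simp
  then have "lqnorm q ?y \<le> e / 2" using y q e by (intro lqnorm_le) auto
  with e y show ?thesis by (intro exI[of _ K]) auto
qed

text \<open>
For nonzero \<open>h \<ge> 0\<close> this is the norming functional of \<open>h\<close>.
\<close>

definition lq_dual :: "real \<Rightarrow> (nat \<Rightarrow> real) \<Rightarrow> (nat \<Rightarrow> real) \<Rightarrow> real" where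
  "lq_dual q h x = (\<Sum>i. (h i / lqnorm q h) powr (q - 1) * x i)"

text \<open>
Hoelder's inequality.  Young's inequality gives it on the unit ball, since the coefficients have
norm 1 in the dual sequence space; homogeneity does the rest.
\<close>

lemma lq_dual_bound:
  assumes q: "1 < q" and h: "h \<in> lq q" "\<And>i. 0 \<le> h i" "0 < lqnorm q h" and x: "x \<in> lq q"
  shows "summable (\<lambda>i. (h i / lqnorm q h) powr (q - 1) * x i)" "\<bar>lq_dual q h x\<bar> \<le> lqnorm q x"
proof -
  let ?c = "\<lambda>i. (h i / lqnorm q h) powr (q - 1)"
  define p where "p = q / (q - 1)"
  have p: "1 < p" "1 / p + 1 / q = 1" "(q - 1) * p = q" using q by (simp_all add: p_def field_simps)
  have cp: "?c i powr p = \<bar>h i\<bar> powr q / lqnorm q h powr q" for i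
    using h(2)[of i] by (simp add: powr_powr p(3) powr_divide)
  have hs: "(\<lambda>i. \<bar>h i\<bar> powr q / lqnorm q h powr q) sums 1"
  proof -
    have "(\<lambda>i. \<bar>h i\<bar> powr q) sums (lqnorm q h powr q)"
      using lqnorm_powr[OF _ h(1)] q h(1) by (simp only: lqsum_def) (auto simp: lq_def)
    from sums_divide[OF this, of "lqnorm q h powr q"] h(3) show ?thesis by simp
  qed
  have unit: "summable (\<lambda>i. ?c i * \<bar>z i\<bar>) \<and> (\<Sum>i. ?c i * \<bar>z i\<bar>) \<le> 1" if z: "z \<in> lq q" "lqnorm q z \<le> 1" for z
  proof -
    have le: "?c i * \<bar>z i\<bar> \<le> \<bar>h i\<bar> powr q / lqnorm q h powr q / p + \<bar>z i\<bar> powr q / q" for i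
      using Youngs_inequality[OF p(1) q p(2), of "?c i" "\<bar>z i\<bar>"] by (simp add: cp)
    have b: "(\<lambda>i. \<bar>h i\<bar> powr q / lqnorm q h powr q / p + \<bar>z i\<bar> powr q / q) sums (1 / p + lqsum q z / q)"
      using z(1) unfolding lq_def lqsum_def by (intro sums_add sums_divide hs summable_sums) auto
    have s: "summable (\<lambda>i. ?c i * \<bar>z i\<bar>)"
      by (rule summable_comparison_test[OF _ sums_summable[OF b]]) (use le in auto)
    have "(\<Sum>i. ?c i * \<bar>z i\<bar>) \<le> 1 / p + lqsum q z / q"
      using suminf_le[OF le s sums_summable[OF b]] sums_unique[OF b] by simp
    also have "lqsum q z / q \<le> 1 / q"
      using lqsum_le[OF _ z] q by (intro divide_right_mono) auto
    finally show ?thesis using s p(2) by simp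
  qed
  have "summable (\<lambda>i. ?c i * \<bar>x i\<bar>) \<and> (\<Sum>i. ?c i * \<bar>x i\<bar>) \<le> lqnorm q x"
  proof (cases "lqnorm q x = 0")
    case True
    then have "x = (\<lambda>i. 0)" using lqnorm_eq_0[OF _ x] q by simp
    then show ?thesis by simp
  next
    case False
    define N where "N = lqnorm q x"
    have N: "0 < N" using False lqnorm_nonneg[of q x] by (simp add: N_def order_less_le)
    let ?z = "\<lambda>i. (1 / N) * x i"
    have "?z \<in> lq q" "lqnorm q ?z \<le> 1" using lq_scale[OF _ x, of "1 / N"] q N by (simp_all add: N_def)
    from unit[OF this] have u: "summable (\<lambda>i. ?c i * \<bar>?z i\<bar>)" "(\<Sum>i. ?c i * \<bar>?z i\<bar>) \<le> 1" by auto
    have e: "N * (?c i * \<bar>?z i\<bar>) = ?c i * \<bar>x i\<bar>" for i using N by (simp add: abs_mult)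
    have "summable (\<lambda>i. ?c i * \<bar>x i\<bar>)" using summable_mult[OF u(1), of N] by (simp only: e)
    moreover have "(\<Sum>i. ?c i * \<bar>x i\<bar>) = N * (\<Sum>i. ?c i * \<bar>?z i\<bar>)"
      using suminf_mult[OF u(1), of N] by (simp only: e)
    ultimately show ?thesis using mult_left_mono[OF u(2), of N] N by (simp add: N_def)
  qed
  then have s: "summable (\<lambda>i. ?c i * \<bar>x i\<bar>)" and b: "(\<Sum>i. ?c i * \<bar>x i\<bar>) \<le> lqnorm q x" by auto
  have e: "\<bar>?c i * x i\<bar> = ?c i * \<bar>x i\<bar>" for i by (simp add: abs_mult)
  show "summable (\<lambda>i. ?c i * x i)"
    by (rule summable_rabs_cancel) (use s in \<open>simp only: e\<close>)
  have "\<bar>lq_dual q h x\<bar> \<le> (\<Sum>i. \<bar>?c i * x i\<bar>)"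
    unfolding lq_dual_def by (rule summable_rabs) (use s in \<open>simp only: e\<close>)
  with b show "\<bar>lq_dual q h x\<bar> \<le> lqnorm q x" by (simp only: e)
qed

lemma lq_dual_linear:
  assumes q: "1 < q" and h: "h \<in> lq q" "\<And>i. 0 \<le> h i" "0 < lqnorm q h" and xy: "x \<in> lq q" "y \<in> lq q"
  shows "lq_dual q h (\<lambda>i. x i + y i) = lq_dual q h x + lq_dual q h y"
    and "lq_dual q h (\<lambda>i. a * x i) = a * lq_dual q h x"
  using suminf_add[OF lq_dual_bound(1)[OF q h xy(1)] lq_dual_bound(1)[OF q h xy(2)]]
    suminf_mult[OF lq_dual_bound(1)[OF q h xy(1)], of a]
  by (simp_all add: lq_dual_def distrib_left mult.left_commute)

text \<open>
The divergent realization evaluates the norming functional of \<open>h\<close> at a vector that agrees with \<open>h\<close>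
except in one coordinate, where it is 0.
\<close>

lemma lq_dual_restriction:
  assumes q: "1 < q" and h: "h \<in> lq q" "0 < lqnorm q h"
    and g: "g \<in> lq q" "\<And>i. 0 \<le> g i" "\<And>i. g i = 0 \<or> h i = g i"
  shows "lq_dual q h g = lqsum q g / lqnorm q h powr (q - 1)"
proof -
  have "(h i / lqnorm q h) powr (q - 1) * g i = \<bar>g i\<bar> powr q / lqnorm q h powr (q - 1)" for i
    using g(3)[of i] g(2)[of i] powr_mult_base[of "g i" "q - 1"]
    by (auto simp: powr_divide mult.commute)
  then show ?thesis
    using g(1) unfolding lq_dual_def lqsum_def lq_def by (simp add: suminf_divide)
qed

lemma lq_dual_norming:
  assumes q: "1 < q" and h: "h \<in> lq q" "\<And>i. 0 \<le> h i" "0 < lqnorm q h"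
  shows "lq_dual q h h = lqnorm q h"
proof -
  have "lqnorm q h powr q = lqnorm q h * lqnorm q h powr (q - 1)"
    using powr_mult_base[of "lqnorm q h" "q - 1"] h(3) by simp
  then show ?thesis
    using lq_dual_restriction[OF q h(1,3) h(1,2)] lqnorm_powr[OF _ h(1)] q h(3) by simp
qed

definition lq_unit :: "nat \<Rightarrow> nat \<Rightarrow> real" where
  "lq_unit j i = (if i = j then 1 else 0)"

lemma lq_unit_facts: "lq_unit j \<in> lq q" "lqnorm q (lq_unit j) = 1"
proof -
  have "(\<lambda>i. \<bar>lq_unit j i\<bar> powr q) = (\<lambda>i. if i = j then 1 else 0)" by (auto simp: lq_unit_def)
  moreover have "(\<lambda>i. if i = j then 1 else 0 :: real) sums 1" using sums_single[of j "\<lambda>_. 1::real"] by simp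
  ultimately have "(\<lambda>i. \<bar>lq_unit j i\<bar> powr q) sums 1" by simp
  then show "lq_unit j \<in> lq q" "lqnorm q (lq_unit j) = 1"
    by (auto simp: lq_def lqnorm_def lqsum_def sums_iff)
qed

lemma lq_dual_unit: "lq_dual q h (\<lambda>i. a * lq_unit j i) = a * (h j / lqnorm q h) powr (q - 1)"
proof -
  have "(\<lambda>i. (h i / lqnorm q h) powr (q - 1) * (a * lq_unit j i)) =
      (\<lambda>i. if i = j then a * (h j / lqnorm q h) powr (q - 1) else 0)"
    by (auto simp: lq_unit_def)
  then show ?thesis unfolding lq_dual_def
    using sums_unique[OF sums_single[of j "\<lambda>_. a * (h j / lqnorm q h) powr (q - 1)"]] by simp
qed

section \<open>An isometric copy of $\ell_q$ on a given type\<close>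

text \<open>
The structure of $\ell_q$ carried over along an injection, so that it lives on the type over which
the Banach spaces range.
\<close>

definition lq_space :: "((nat \<Rightarrow> real) \<Rightarrow> 'a) \<Rightarrow> real \<Rightarrow> 'a normed_struct" where
  "lq_space \<iota> q = \<lparr>carrier = \<iota> ` lq q, mult = undefined, one = undefined, zero = \<iota> (\<lambda>i. 0),
     add = (\<lambda>a b. \<iota> (\<lambda>i. inv_into UNIV \<iota> a i + inv_into UNIV \<iota> b i)), smult = (\<lambda>c a. \<iota> (\<lambda>i. c * inv_into UNIV \<iota> a i)),
     nrm = (\<lambda>a. lqnorm q (inv_into UNIV \<iota> a))\<rparr>"

locale embedded_lq =
  fixes \<iota> :: "(nat \<Rightarrow> real) \<Rightarrow> 'a" and q :: real
  assumes inj: "inj \<iota>" and q: "1 < q" "q \<le> 2"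
begin

abbreviation X :: "'a normed_struct" where "X \<equiv> lq_space \<iota> q"

lemma q01: "0 < q" "1 \<le> q" using q by auto

lemma inv_embedding [simp]: "inv_into UNIV \<iota> (\<iota> x) = x"
  using inj by simp

lemma lq_space_simps [simp]:
  "carrier X = \<iota> ` lq q" "\<zero>\<^bsub>X\<^esub> = \<iota> (\<lambda>i. 0)" "\<iota> x \<oplus>\<^bsub>X\<^esub> \<iota> y = \<iota> (\<lambda>i. x i + y i)"
  "a \<odot>\<^bsub>X\<^esub> \<iota> x = \<iota> (\<lambda>i. a * x i)" "nrm X (\<iota> x) = lqnorm q x"
  by (simp_all add: lq_space_def)

lemma module_lq_space: "Module.module real_ring X"
proof (rule moduleI)
  show "abelian_group X"
  proof (rule abelian_groupI)
    fix a assume "a \<in> carrier X"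
    then obtain x where x: "a = \<iota> x" "x \<in> lq q" by auto
    then have "\<iota> (\<lambda>i. - 1 * x i) \<in> carrier X" "\<iota> (\<lambda>i. - 1 * x i) \<oplus>\<^bsub>X\<^esub> a = \<zero>\<^bsub>X\<^esub>"
      using lq_scale(1)[OF q01(1), of x "-1"] by auto
    then show "\<exists>b\<in>carrier X. b \<oplus>\<^bsub>X\<^esub> a = \<zero>\<^bsub>X\<^esub>" by blast
  qed (auto simp: lq_add[OF q01(2)] lq_zero add_ac)
qed (auto simp: real_ring_def cring_real_ring[unfolded real_ring_def] lq_scale[OF q01(1)] algebra_simps)

lemma real_normed_space_lq: "real_normed_space X"
  unfolding real_normed_space_def
proof (intro conjI ballI allI)
  show "Module.module real_ring X" by (rule module_lq_space)
  show "nrm X a = 0 \<longleftrightarrow> a = \<zero>\<^bsub>X\<^esub>" if "a \<in> carrier X" for a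
    using that lqnorm_eq_0[OF q01(1)] inj by (auto simp: inj_eq)
  show "nrm X (c \<odot>\<^bsub>X\<^esub> a) = \<bar>c\<bar> * nrm X a" if "a \<in> carrier X" for a c
    using that lq_scale[OF q01(1)] by auto
  show "nrm X (a \<oplus>\<^bsub>X\<^esub> b) \<le> nrm X a + nrm X b" if "a \<in> carrier X" "b \<in> carrier X" for a b
    using that lqnorm_triangle[OF q01(2)] by auto
qed

sublocale normed_vspace X
  by unfold_locales (rule real_normed_space_lq)

lemma minus_lq [simp]: "x \<in> lq q \<Longrightarrow> y \<in> lq q \<Longrightarrow> \<iota> x \<ominus>\<^bsub>X\<^esub> \<iota> y = \<iota> (\<lambda>i. x i - y i)"
  by (subst minus_conv) auto

lemma neg_lq [simp]: "x \<in> lq q \<Longrightarrow> \<ominus>\<^bsub>X\<^esub> \<iota> x = \<iota> (\<lambda>i. - x i)"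
  by (subst neg_smult) auto

lemma ndist_lq: "x \<in> lq q \<Longrightarrow> y \<in> lq q \<Longrightarrow> ndist X (\<iota> x) (\<iota> y) = lqnorm q (\<lambda>i. x i - y i)"
  by (simp add: ndist_def)

lemma banach_space_lq: "banach_space X"
proof -
  interpret MS: Metric_space "carrier X" "ndist X" by (rule Metric_space_ndist[OF real_normed_space_lq])
  have "MS.mcomplete" unfolding MS.mcomplete_def
  proof (intro allI impI)
    fix s assume s: "MS.MCauchy s"
    define \<sigma> where "\<sigma> n = inv_into UNIV \<iota> (s n)" for n
    have "s n \<in> \<iota> ` lq q" for n using s unfolding MS.MCauchy_def by auto
    then have \<sigma>: "\<sigma> n \<in> lq q" "s n = \<iota> (\<sigma> n)" for n unfolding \<sigma>_def by (metis image_iff inv_embedding)+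
    have "\<exists>N. \<forall>n\<ge>N. \<forall>m\<ge>N. lqnorm q (\<lambda>i. \<sigma> n i - \<sigma> m i) < e" if "0 < e" for e
      using s that \<sigma> unfolding MS.MCauchy_def by (simp add: ndist_lq)
    from lq_complete[OF q01(2) \<sigma>(1) this] obtain y where y: "y \<in> lq q"
      "\<And>e. 0 < e \<Longrightarrow> \<exists>N. \<forall>n\<ge>N. lqnorm q (\<lambda>i. \<sigma> n i - y i) \<le> e" by blast
    have "limitin MS.mtopology s (\<iota> y) sequentially"
      unfolding MS.limitin_metric
    proof (intro conjI allI impI)
      show "\<iota> y \<in> carrier X" using y by simp
      fix e :: real assume e: "0 < e"
      then obtain N where "\<And>n. n \<ge> N \<Longrightarrow> lqnorm q (\<lambda>i. \<sigma> n i - y i) \<le> e / 2" using y(2)[of "e / 2"] by auto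
      with e have "ndist X (s n) (\<iota> y) < e" if "n \<ge> N" for n
        using that \<sigma> y(1) by (force simp: ndist_lq)
      then show "\<forall>\<^sub>F n in sequentially. s n \<in> carrier X \<and> ndist X (s n) (\<iota> y) < e"
        using \<sigma> by (auto simp: eventually_sequentially)
    qed
    then show "\<exists>x. limitin MS.mtopology s x sequentially" ..
  qed
  with real_normed_space_lq show ?thesis by (simp add: banach_space_def)
qed

lemma power_smooth_lq: "X \<in> power_smooth q"
proof -
  have "modulus_of_smoothness X u \<le> 1 * u powr q" if u: "0 \<le> u" for u
    unfolding modulus_of_smoothness_def
  proof (rule cSUP_least)
    have "(\<iota> (lq_unit 0), \<iota> (lq_unit 0)) \<in> {(x, y). x \<in> carrier X \<and> y \<in> carrier X \<and> nrm X x = 1 \<and> nrm X y = 1}"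
      using lq_unit_facts[where j=0 and q=q] by simp
    then show "{(x, y). x \<in> carrier X \<and> y \<in> carrier X \<and> nrm X x = 1 \<and> nrm X y = 1} \<noteq> {}" by blast
    fix z assume "z \<in> {(x, y). x \<in> carrier X \<and> y \<in> carrier X \<and> nrm X x = 1 \<and> nrm X y = 1}"
    then obtain x y where z: "z = (\<iota> x, \<iota> y)" and xy: "x \<in> lq q" "y \<in> lq q" "lqnorm q x = 1" "lqnorm q y = 1" by auto
    let ?y = "\<lambda>i. u * y i"
    have y: "?y \<in> lq q" "lqnorm q ?y = u" using lq_scale[OF q01(1) xy(2)] xy u by auto
    define T where "T = (lqnorm q (\<lambda>i. x i + u * y i) + lqnorm q (\<lambda>i. x i - u * y i)) / 2"
    have T0: "0 \<le> T" by (simp add: T_def)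
    have "T powr q \<le> 1 + u powr q"
      using lq_smoothness[OF q01(2) q(2) xy(1) y(1)] lqnorm_powr[OF q01(1) xy(1)] lqnorm_powr[OF q01(1) y(1)] xy y(2)
      by (simp add: T_def)
    also have "\<dots> \<le> (1 + u powr q) powr q"
      using powr_mono[of 1 q "1 + u powr q"] q by simp
    finally have "T \<le> 1 + u powr q"
      using powr_less_mono2[of q "1 + u powr q" T] q T0 by force
    then show "(case z of (x, y) \<Rightarrow> (nrm X (x \<oplus>\<^bsub>X\<^esub> u \<odot>\<^bsub>X\<^esub> y) + nrm X (x \<ominus>\<^bsub>X\<^esub> u \<odot>\<^bsub>X\<^esub> y)) / 2 - 1) \<le> 1 * u powr q"
      using xy y by (simp add: z T_def field_simps)
  qed
  then show ?thesis using banach_space_lq unfolding power_smooth_def by (auto intro!: exI[of _ 1])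
qed

lemma finite_support_in_span:
  assumes "T \<subseteq> carrier X" "\<And>j. j \<in> S \<Longrightarrow> \<iota> (lq_unit j) \<in> T" "\<And>i. y i \<noteq> 0 \<Longrightarrow> i \<in> S \<and> i < (K::nat)"
  shows "y \<in> lq q \<and> \<iota> y \<in> lin_span X T"
  using assms(3)
proof (induction K arbitrary: y)
  case 0
  then have "y = (\<lambda>i. 0)" by auto
  then show ?case using lin_span_closed(2)[OF assms(1)] lq_zero by simp
next
  case (Suc K)
  have "y(K := 0) \<in> lq q \<and> \<iota> (y(K := 0)) \<in> lin_span X T"
    using Suc.prems by (intro Suc.IH) (auto simp: less_Suc_eq split: if_splits)
  then have y': "y(K := 0) \<in> lq q" "\<iota> (y(K := 0)) \<in> lin_span X T" by auto
  show ?case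
  proof (cases "y K = 0")
    case True
    then show ?thesis using y' by (simp add: fun_upd_idem)
  next
    case False
    then have "\<iota> (lq_unit K) \<in> lin_span X T" using Suc.prems assms(2) lin_span_superset by blast
    then have "\<iota> (y(K := 0)) \<oplus>\<^bsub>X\<^esub> y K \<odot>\<^bsub>X\<^esub> \<iota> (lq_unit K) \<in> lin_span X T"
      using y'(2) lin_span_closed(3,4)[OF assms(1)] by blast
    moreover have "\<iota> (y(K := 0)) \<oplus>\<^bsub>X\<^esub> y K \<odot>\<^bsub>X\<^esub> \<iota> (lq_unit K) = \<iota> y"
      by simp (rule arg_cong[of _ _ \<iota>], auto simp: lq_unit_def)
    ultimately have "\<iota> y \<in> lin_span X T" by simp
    then have "\<iota> y \<in> \<iota> ` lq q" using lin_span_closed(1)[OF assms(1)] by auto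
    then show ?thesis using \<open>\<iota> y \<in> lin_span X T\<close> inj by (auto simp: inj_eq)
  qed
qed

text \<open>
The coordinates outside \<open>S\<close> of an element cannot be approximated from this span, which bounds best
errors from below.
\<close>

lemma span_support:
  assumes "a \<in> lin_span X ((\<lambda>j. \<iota> (lq_unit j)) ` S)"
  shows "\<exists>y\<in>lq q. a = \<iota> y \<and> (\<forall>i. y i \<noteq> 0 \<longrightarrow> i \<in> S)"
proof -
  let ?H = "{a. \<exists>y\<in>lq q. a = \<iota> y \<and> (\<forall>i. y i \<noteq> 0 \<longrightarrow> i \<in> S)}"
  have "submodule ?H real_ring X"
  proof (rule submoduleI)
    show "?H \<subseteq> carrier X" by auto
    show "\<zero>\<^bsub>X\<^esub> \<in> ?H" using lq_zero by force
    fix a assume "a \<in> ?H"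
    then obtain x where x: "a = \<iota> x" "x \<in> lq q" "\<forall>i. x i \<noteq> 0 \<longrightarrow> i \<in> S" by auto
    show smult: "c \<odot>\<^bsub>X\<^esub> a \<in> ?H" for c
      using x lq_scale(1)[OF q01(1) x(2), of c] by (auto intro!: bexI[of _ "\<lambda>i. c * x i"])
    show "\<ominus>\<^bsub>X\<^esub> a \<in> ?H" using smult[of "-1"] neg_smult[of a] x by simp
    fix b assume "b \<in> ?H"
    then obtain y where y: "b = \<iota> y" "y \<in> lq q" "\<forall>i. y i \<noteq> 0 \<longrightarrow> i \<in> S" by auto
    show "a \<oplus>\<^bsub>X\<^esub> b \<in> ?H"
      using x y lq_add[OF q01(2) x(2) y(2)] by (auto intro!: bexI[of _ "\<lambda>i. x i + y i"]) (metis add_0)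
  qed
  moreover have "(\<lambda>j. \<iota> (lq_unit j)) ` S \<subseteq> ?H"
    using lq_unit_facts(1)[of _ q] by (auto intro!: bexI[of _ "lq_unit _"] simp: lq_unit_def split: if_splits)
  ultimately show ?thesis using lin_span_minimal assms by blast
qed

definition signed_basis :: "'a set" where
  "signed_basis = {\<iota> (\<lambda>i. a * lq_unit j i) | a j. a = 1 \<or> a = - 1}"

lemma unit_in_signed_basis: "\<iota> (lq_unit j) \<in> signed_basis"
  unfolding signed_basis_def by (auto intro!: exI[of _ 1] exI[of _ j])

lemma signed_basis_carrier: "signed_basis \<subseteq> carrier X"
  unfolding signed_basis_def using lq_scale(1)[OF q01(1) lq_unit_facts(1)] by auto

lemma dictionary_signed_basis: "dictionary X signed_basis"
  unfolding dictionary_def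
proof (intro conjI ballI)
  interpret MS: Metric_space "carrier X" "ndist X" by (rule Metric_space_ndist[OF real_normed_space_lq])
  show "signed_basis \<subseteq> carrier X" by (rule signed_basis_carrier)
  show "nrm X g = 1" if "g \<in> signed_basis" for g
  proof -
    from that obtain a j where a: "g = \<iota> (\<lambda>i. a * lq_unit j i)" "a = 1 \<or> a = - 1" by (auto simp: signed_basis_def)
    then show ?thesis using lq_scale(2)[OF q01(1) lq_unit_facts(1), of a j] lq_unit_facts(2) by auto
  qed
  show "\<ominus>\<^bsub>X\<^esub> g \<in> signed_basis" if g: "g \<in> signed_basis" for g
  proof -
    from g obtain a j where a: "g = \<iota> (\<lambda>i. a * lq_unit j i)" "a = 1 \<or> a = - 1" by (auto simp: signed_basis_def)
    have "\<ominus>\<^bsub>X\<^esub> g = \<iota> (\<lambda>i. (- a) * lq_unit j i)"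
      using lq_scale(1)[OF q01(1) lq_unit_facts(1), of a j] by (simp add: a(1))
    then show ?thesis using a(2) unfolding signed_basis_def by force
  qed
  have "a \<in> MS.mtopology closure_of lin_span X signed_basis" if "a \<in> carrier X" for a
    unfolding MS.metric_closure_of
  proof (intro CollectI conjI allI impI that)
    fix e :: real assume e: "0 < e"
    from that obtain x where x: "a = \<iota> x" "x \<in> lq q" by auto
    from lq_tail_small[OF q01(2) x(2) e] obtain K where K: "lqnorm q (\<lambda>i. if i < K then 0 else x i) < e" by auto
    let ?y = "\<lambda>i. if i < K then x i else 0"
    have y: "?y \<in> lq q" "\<iota> ?y \<in> lin_span X signed_basis"
      using finite_support_in_span[OF signed_basis_carrier, of UNIV ?y K] unit_in_signed_basis
      by (auto split: if_splits)
    have "(\<lambda>i. x i - ?y i) = (\<lambda>i. if i < K then 0 else x i)" by auto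
    then have "\<iota> ?y \<in> MS.mball a e" using K x y unfolding MS.in_mball by (simp add: ndist_lq)
    with y(2) show "\<exists>y\<in>lin_span X signed_basis. y \<in> MS.mball a e" ..
  qed
  then show "MS.mtopology closure_of lin_span X signed_basis = carrier X"
    by (intro subset_antisym subsetI) (auto simp only: MS.metric_closure_of)
qed

definition lq_functional :: "(nat \<Rightarrow> real) \<Rightarrow> 'a \<Rightarrow> real" where
  "lq_functional h a = lq_dual q h (inv_into UNIV \<iota> a)"

lemma lq_functional_norm_le_1:
  assumes h: "h \<in> lq q" "\<And>i. 0 \<le> h i" "0 < lqnorm q h"
  shows "bounded_linear_functional X (lq_functional h)" "functional_norm X (lq_functional h) \<le> 1"
proof -
  have b: "\<bar>lq_functional h a\<bar> \<le> nrm X a" if "a \<in> carrier X" for a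
    using that lq_dual_bound(2)[OF q(1) h] by (auto simp: lq_functional_def)
  show "bounded_linear_functional X (lq_functional h)"
    unfolding bounded_linear_functional_def linear_functional_def
    using lq_dual_linear[OF q(1) h] lq_dual_bound(2)[OF q(1) h] by (auto simp: lq_functional_def intro!: exI[of _ 1])
  show "functional_norm X (lq_functional h) \<le> 1"
    unfolding functional_norm_def
  proof (rule cSUP_least)
    have "\<iota> (\<lambda>i. 0) \<in> {x \<in> carrier X. nrm X x \<le> 1}" by (simp add: lq_zero)
    then show "{x \<in> carrier X. nrm X x \<le> 1} \<noteq> {}" by blast
  qed (use b in force)
qed

text \<open>
As no coordinate of \<open>h\<close> exceeds 1, the largest value on the dictionary is at most that of a
coordinate equal to 1.  A coordinate of size \<open>\<tau> powr (1 / (q - 1))\<close> is therefore large enough to be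
picked with weakness \<open>\<tau>\<close>.
\<close>

lemma lq_functional_weak_greedy:
  assumes h: "\<And>i. 0 \<le> h i" "\<And>i. h i \<le> 1" "0 < lqnorm q h" and \<tau>: "0 \<le> \<tau>" "\<tau> \<le> h j powr (q - 1)"
  shows "\<tau> * (SUP g\<in>signed_basis. lq_functional h g) \<le> lq_functional h (\<iota> (lq_unit j))"
proof -
  define N where "N = lqnorm q h"
  have val: "lq_functional h (\<iota> (\<lambda>i. a * lq_unit k i)) = a * (h k / N) powr (q - 1)" for a k
    by (simp add: lq_functional_def lq_dual_unit N_def)
  have "(SUP g\<in>signed_basis. lq_functional h g) \<le> 1 / N powr (q - 1)"
  proof (rule cSUP_least)
    show "signed_basis \<noteq> {}" using unit_in_signed_basis by auto
    fix g assume "g \<in> signed_basis"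
    then obtain a k where g: "g = \<iota> (\<lambda>i. a * lq_unit k i)" "a = 1 \<or> a = - 1" by (auto simp: signed_basis_def)
    have "a * (h k / N) powr (q - 1) \<le> 1 * (h k / N) powr (q - 1)"
      using g(2) by (intro mult_right_mono) auto
    also have "\<dots> \<le> 1 * (1 / N) powr (q - 1)"
      using h q by (intro mult_left_mono powr_mono2) (auto simp: N_def divide_right_mono)
    finally show "lq_functional h g \<le> 1 / N powr (q - 1)"
      using h(3) by (simp add: g(1) val N_def powr_divide)
  qed
  then have "\<tau> * (SUP g\<in>signed_basis. lq_functional h g) \<le> \<tau> * (1 / N powr (q - 1))"
    using \<tau>(1) by (rule mult_left_mono)
  also have "\<dots> \<le> h j powr (q - 1) * (1 / N powr (q - 1))"
    using \<tau>(2) by (intro mult_right_mono) auto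
  also have "\<dots> = lq_functional h (\<iota> (lq_unit j))"
    using val[of 1 j] h(1,3) by (simp add: N_def powr_divide)
  finally show ?thesis .
qed

end

section \<open>A divergent realization in $\ell_q$\<close>

context embedded_lq
begin

text \<open>
Write \<open>s n = t (n + 1) powr p\<close> with \<open>p = q / (q - 1)\<close>, and \<open>w n = t (n + 1) powr (1 / (q - 1))\<close>, so that
\<open>w n powr q = s n\<close>.  The element \<open>f\<close> has coordinates 1 at \<open>0, \<dots>, m\<close> and \<open>w n\<close> at \<open>m + n\<close> for
\<open>n \<in> L\<close>; it lies in $\ell_q$ because \<open>s\<close> is summable over \<open>L\<close>.  The realization never picks one
of the basis vectors \<open>1, \<dots>, m\<close>, so every remainder keeps norm at least 1.

The first pick is the basis vector 0.  Later steps are of three kinds.  For \<open>n \<in> L\<close> everything is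
exact and the coordinate \<open>m + n\<close> of size \<open>w n\<close> is just large enough to be picked.  For \<open>n \<notin> L\<close> the
basis vector 0 is picked again, which gains nothing.  If \<open>\<eta> n\<close> is large, the inexact approximant
leaves \<open>w n\<close> in the coordinate 0 of the remainder; if \<open>\<delta> n\<close> is large, the remainder is exact but
the functional is the norming one for the remainder with \<open>w n\<close> added at 0.  Either change alters
the \<open>q\<close>-th power of the norm, which is at least \<open>m\<close>, by \<open>s n\<close>, so relative errors of \<open>s n / m\<close>
suffice.
\<close>

lemma divergent_realization:
  fixes t \<delta> \<eta> :: "nat \<Rightarrow> real" and L :: "nat set" and m :: nat
  assumes t: "weakness_seq t" and \<delta>: "perturbation_seq \<delta>" and \<eta>: "error_seq \<eta>"
    and L: "0 \<notin> L" and sum: "summable (\<lambda>n. if n \<in> L then t (n + 1) powr (q / (q - 1)) else 0)"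
    and m: "1 \<le> m"
    and bad: "\<And>n. 1 \<le> n \<Longrightarrow> n \<notin> L \<Longrightarrow>
      t (n + 1) powr (q / (q - 1)) \<le> m * \<delta> n \<or> t (n + 1) powr (q / (q - 1)) \<le> m * \<eta> n"
  shows "\<exists>f\<in>carrier X. \<not> awcga_converges X signed_basis t \<delta> \<eta> f"
proof -
  define s where "s n = t (n + 1) powr (q / (q - 1))" for n
  define w where "w n = t (n + 1) powr (1 / (q - 1))" for n
  have t01: "0 \<le> t (n + 1)" "t (n + 1) \<le> 1" for n using t by (auto simp: weakness_seq_def)
  have w01: "0 \<le> w n" "w n \<le> 1" for n
    using t01[of n] q powr_mono2[of "1 / (q - 1)" "t (n + 1)" 1] by (auto simp: w_def)
  have wq1: "w n powr (q - 1) = t (n + 1)" for n using q t01[of n] by (simp add: w_def powr_powr)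
  have wq: "w n powr q = s n" for n using q by (simp add: w_def s_def powr_powr)
  have \<delta>01: "0 \<le> \<delta> n" "\<delta> n \<le> 1" for n using \<delta> by (auto simp: perturbation_seq_def)
  have \<eta>0: "0 \<le> \<eta> n" if "1 \<le> n" for n using \<eta> that by (auto simp: error_seq_def)
  \<comment> \<open>For \<open>n \<ge> 1\<close>, \<open>g n\<close> is the exact remainder; \<open>x n\<close> is the actual one, \<open>h n\<close> the vector whose norming functional is used, \<open>j n\<close> the coordinate picked next.\<close>
  define g where "g n i = (if i = 0 then 0 else if i \<le> m then 1
    else if n \<le> i - m \<and> i - m \<in> L then w (i - m) else 0)" for n i
  define b where "b n = (if n = 0 then 1 else if n \<in> L then 0 else w n)" for n
  define c where "c n = (if n = 0 then 1 else if n \<notin> L \<and> s n \<le> m * \<eta> n then w n else 0)" for n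
  define h where "h n = (g n)(0 := b n)" for n
  define x where "x n = (g n)(0 := c n)" for n
  define j where "j k = (if k \<in> L then m + k else 0)" for k
  have b01: "0 \<le> b n" "b n \<le> 1" and c01: "0 \<le> c n" "c n \<le> 1" for n
    using w01[of n] by (auto simp: b_def c_def)
  have g01: "0 \<le> g n i" "g n i \<le> 1" for n i using w01 by (auto simp: g_def)
  have h01: "0 \<le> h n i" "h n i \<le> 1" for n i using g01 b01 by (auto simp: h_def)
  have upd: "(g n)(0 := a) \<in> lq q \<and> lqsum q ((g n)(0 := a)) = \<bar>a\<bar> powr q + lqsum q (g n)" for n a
  proof -
    have sg: "summable (\<lambda>i. \<bar>g n i\<bar> powr q)"
    proof -
      have "summable (\<lambda>i. \<bar>g n (i + m)\<bar> powr q)"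
      proof (rule summable_comparison_test)
        show "summable (\<lambda>i. (if i = 0 then 1 else 0) + (if i \<in> L then s i else 0))"
          using sum sums_summable[OF sums_single[of 0 "\<lambda>_. 1::real"]] unfolding s_def by (intro summable_add) auto
        have "\<bar>g n (i + m)\<bar> powr q \<le> (if i = 0 then 1 else 0) + (if i \<in> L then s i else 0)" for i
          using m wq[of i] w01[of i] by (cases "i = 0") (auto simp: g_def s_def)
        then show "\<exists>N. \<forall>i\<ge>N. norm (\<bar>g n (i + m)\<bar> powr q) \<le> (if i = 0 then 1 else 0) + (if i \<in> L then s i else 0)"
          by simp
      qed
      then show ?thesis by (simp only: summable_iff_shift[of "\<lambda>i. \<bar>g n i\<bar> powr q"])
    qed
    have "(\<lambda>i. if i = 0 then \<bar>a\<bar> powr q else 0) sums (\<bar>a\<bar> powr q)"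
      using sums_single[of 0 "\<lambda>_. \<bar>a\<bar> powr q"] by simp
    from sums_add[OF this summable_sums[OF sg]]
    have "(\<lambda>i. \<bar>((g n)(0 := a)) i\<bar> powr q) sums (\<bar>a\<bar> powr q + lqsum q (g n))"
      unfolding lqsum_def by (rule sums_cong[THEN iffD1, rotated]) (auto simp: g_def)
    then show ?thesis by (auto simp: lq_def lqsum_def sums_iff)
  qed
  have g: "g n \<in> lq q" for n using upd[of n 0] by (simp add: fun_upd_idem g_def)
  have h: "h n \<in> lq q" "lqsum q (h n) = b n powr q + lqsum q (g n)" for n
    using upd[of n "b n"] b01 by (simp_all add: h_def)
  have x: "x n \<in> lq q" "lqsum q (x n) = c n powr q + lqsum q (g n)" for n
    using upd[of n "c n"] c01 by (simp_all add: x_def)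
  have gm: "m \<le> lqsum q (g n)" for n
  proof -
    have "real m = (\<Sum>i\<in>{1..m}. \<bar>g n i\<bar> powr q)" by (simp add: g_def)
    also have "\<dots> \<le> lqsum q (g n)"
      unfolding lqsum_def by (rule sum_le_suminf) (use g[of n] in \<open>auto simp: lq_def\<close>)
    finally show ?thesis .
  qed
  have one: "1 \<le> lqnorm q z" if "z \<in> lq q" "z 1 = 1" for z
    using lq_coord_le[OF q01(1) that(1), of 1] that(2) by simp
  have at1: "g n 1 = 1" "h n 1 = 1" "x n 1 = 1" for n using m by (simp_all add: g_def h_def x_def)
  have hpos: "0 < lqnorm q (h n)" for n using one[OF h(1) at1(2), of n] by linarith
  note Fh = lq_functional_norm_le_1[OF h(1) h01(1) hpos]
  have greedy: "t (n + 1) * (SUP g\<in>signed_basis. lq_functional (h n) g) \<le> lq_functional (h n) (\<iota> (lq_unit (j n)))" for n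
  proof (rule lq_functional_weak_greedy[OF h01 hpos t01(1)])
    show "t (n + 1) \<le> h n (j n) powr (q - 1)"
      using t01(2)[of n] wq1[of n] m L by (auto simp: h_def j_def b_def g_def)
  qed
  have norming: "(1 - \<delta> n) * lqnorm q (x n) \<le> lq_dual q (h n) (x n)" for n
  proof (cases "x n = h n")
    case True
    have "(1 - \<delta> n) * lqnorm q (h n) \<le> 1 * lqnorm q (h n)" using \<delta>01 by (intro mult_right_mono) auto
    then show ?thesis using lq_dual_norming[OF q(1) h(1) h01(1) hpos] True by simp
  next
    case False
    then have n: "1 \<le> n" "n \<notin> L" "\<not> s n \<le> m * \<eta> n" by (auto simp: x_def h_def b_def c_def split: if_splits)
    then have sd: "s n \<le> m * \<delta> n" using bad[OF n(1,2)] by (simp add: s_def)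
    have xg: "x n = g n" using n by (auto simp: x_def c_def g_def)
    define A where "A = lqsum q (g n)"
    define B where "B = lqnorm q (h n)"
    have hB: "B powr q = s n + A" using lqnorm_powr[OF q01(1) h(1)] h(2) n wq by (simp add: A_def B_def b_def)
    have Bpos: "0 < B" using hpos by (simp add: B_def)
    have "s n \<le> \<delta> n * A" using sd mult_left_mono[OF gm, of "\<delta> n" n] \<delta>01(1)[of n] by (simp add: A_def mult.commute)
    also have "\<dots> \<le> \<delta> n * (s n + A)" using \<delta>01(1)[of n] by (intro mult_left_mono) (auto simp: s_def)
    finally have "(1 - \<delta> n) * B powr q \<le> A" by (simp add: hB algebra_simps)
    moreover have "B powr q = B * B powr (q - 1)" using powr_mult_base[of B "q - 1"] Bpos by simp
    ultimately have "(1 - \<delta> n) * B \<le> A / B powr (q - 1)" using Bpos by (simp add: field_simps)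
    also have "A / B powr (q - 1) = lq_dual q (h n) (g n)"
      unfolding A_def B_def by (rule lq_dual_restriction[symmetric, OF q(1) h(1) hpos g g01(1)]) (auto simp: h_def g_def)
    finally have 1: "(1 - \<delta> n) * B \<le> lq_dual q (h n) (x n)" by (simp add: xg)
    have "A \<le> B powr q" using hB by (simp add: s_def)
    then have "lqnorm q (g n) \<le> B" using Bpos by (intro lqnorm_le q01 g) (auto simp: A_def)
    then have "(1 - \<delta> n) * lqnorm q (x n) \<le> (1 - \<delta> n) * B" using \<delta>01(2)[of n] by (intro mult_left_mono) (auto simp: xg)
    with 1 show ?thesis by simp
  qed
  have near: "lqnorm q (x n) \<le> (1 + \<eta> n) * lqnorm q (g n)" if n: "1 \<le> n" for n
  proof (rule lqnorm_le[OF q01(1) x(1)])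
    show "0 \<le> (1 + \<eta> n) * lqnorm q (g n)" using \<eta>0[OF n] by simp
    define A where "A = lqsum q (g n)"
    have A: "m \<le> A" "0 \<le> A" using gm[of n] by (simp_all add: A_def)
    have "c n powr q \<le> m * \<eta> n" using n wq[of n] \<eta>0[OF n] by (auto simp: c_def)
    also have "\<dots> \<le> A * \<eta> n" using A \<eta>0[OF n] by (intro mult_right_mono)
    finally have "lqsum q (x n) \<le> (1 + \<eta> n) * A" by (simp add: x(2) A_def algebra_simps)
    also have "\<dots> \<le> (1 + \<eta> n) powr q * A"
      using powr_mono[of 1 q "1 + \<eta> n"] q \<eta>0[OF n] A by (intro mult_right_mono) auto
    also have "\<dots> = ((1 + \<eta> n) * lqnorm q (g n)) powr q"
      using \<eta>0[OF n] lqnorm_powr[OF q01(1) g[of n]] by (simp add: powr_mult A_def)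
    finally show "lqsum q (x n) \<le> ((1 + \<eta> n) * lqnorm q (g n)) powr q" .
  qed
  define S where "S n = j ` {..<n}" for n
  have f_off: "x 0 i = g n i" if "i \<notin> S n" "1 \<le> n" for i n
  proof -
    have "i \<noteq> 0" using that L by (force simp: S_def j_def)
    moreover have "\<not> (i > m \<and> i - m \<in> L \<and> i - m < n)" using that(1) by (force simp: S_def j_def)
    ultimately show ?thesis by (auto simp: x_def g_def)
  qed
  have g_on: "g n i = 0" if "i \<in> S n" for i n
    using that L by (auto simp: S_def j_def g_def)
  have S0: "0 \<in> S n" if "1 \<le> n" for n using that L by (force simp: S_def j_def)
  have x_off: "x n i = g n i" if "i \<notin> S n" "1 \<le> n" for i n
    using that S0 by (auto simp: x_def)
  define \<phi> where "\<phi> n = \<iota> (lq_unit (j (n - 1)))" for n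
  define G where "G n = \<iota> (\<lambda>i. x 0 i - x n i)" for n
  have \<phi>_image: "\<phi> ` {1..n} = (\<lambda>k. \<iota> (lq_unit k)) ` S n" for n
  proof -
    have "{..<n} = (\<lambda>k. k - 1) ` {1..n}" by (force simp: image_iff intro: bexI[of _ "Suc _"])
    then show ?thesis by (simp add: S_def \<phi>_def image_image)
  qed
  have GV: "G n \<in> lin_span X (\<phi> ` {1..n})" if n: "1 \<le> n" for n
  proof -
    have "finite (S n)" by (simp add: S_def)
    then obtain K where K: "\<forall>i\<in>S n. i < K" using finite_nat_set_iff_bounded by blast
    have "\<phi> ` {1..n} \<subseteq> carrier X" using lq_unit_facts(1) by (auto simp: \<phi>_def)
    moreover have "\<iota> (lq_unit k) \<in> \<phi> ` {1..n}" if "k \<in> S n" for k using that unfolding \<phi>_image by (rule imageI)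
    moreover have "i \<in> S n \<and> i < K" if "x 0 i - x n i \<noteq> 0" for i
      using that K f_off[OF _ n, of i] x_off[OF _ n, of i] by (cases "i \<in> S n") auto
    ultimately have "\<iota> (\<lambda>i. x 0 i - x n i) \<in> lin_span X (\<phi> ` {1..n})"
      by (intro finite_support_in_span[THEN conjunct2])
    then show ?thesis by (simp add: G_def)
  qed
  have minus: "\<iota> (x 0) \<ominus>\<^bsub>X\<^esub> G n = \<iota> (x n)" for n
    unfolding G_def using x(1) lq_diff[OF q01(2) x(1) x(1)] by simp
  \<comment> \<open>Elements of the span vanish off \<open>S n\<close>, where \<open>f\<close> agrees with \<open>g n\<close>; on \<open>S n\<close> the vector \<open>g n\<close> vanishes.\<close>
  have best: "lqnorm q (g n) \<le> best_approx_error X (\<iota> (x 0)) (lin_span X (\<phi> ` {1..n}))" if n: "1 \<le> n" for n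
    unfolding best_approx_error_def
  proof (rule cINF_greatest)
    show "lin_span X (\<phi> ` {1..n}) \<noteq> {}" using GV[OF n] by auto
    fix a assume "a \<in> lin_span X (\<phi> ` {1..n})"
    then obtain y where y: "y \<in> lq q" "a = \<iota> y" "\<And>i. y i \<noteq> 0 \<Longrightarrow> i \<in> S n"
      using span_support unfolding \<phi>_image by blast
    have d: "(\<lambda>i. x 0 i - y i) \<in> lq q" by (rule lq_diff[OF q01(2) x(1) y(1)])
    have "\<bar>g n i\<bar> powr q \<le> \<bar>x 0 i - y i\<bar> powr q" for i
      using g_on[of i n] f_off[OF _ n, of i] y(3)[of i] by (cases "i \<in> S n"; cases "y i = 0") auto
    from lqI_dominated(2)[of "g n", OF this] d have "lqsum q (g n) \<le> lqsum q (\<lambda>i. x 0 i - y i)"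
      by (simp add: lq_def lqsum_def)
    also have "\<dots> = lqnorm q (\<lambda>i. x 0 i - y i) powr q" using lqnorm_powr[OF q01(1) d] by simp
    finally have "lqnorm q (g n) \<le> lqnorm q (\<lambda>i. x 0 i - y i)" by (intro lqnorm_le q01 g) auto
    then show "lqnorm q (g n) \<le> nrm X (\<iota> (x 0) \<ominus>\<^bsub>X\<^esub> a)" using y x by simp
  qed
  have "awcga_realization X signed_basis t \<delta> \<eta> (\<iota> (x 0)) (\<lambda>n. lq_functional (h n)) \<phi> G (\<lambda>n. \<iota> (x n))"
    unfolding awcga_realization_def
  proof (intro conjI allI impI)
    fix n :: nat assume n: "1 \<le> n"
    show "(1 - \<delta> (n - 1)) * nrm X (\<iota> (x (n - 1))) \<le> lq_functional (h (n - 1)) (\<iota> (x (n - 1)))"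
      using norming by (simp add: lq_functional_def)
    show "\<phi> n \<in> signed_basis" using unit_in_signed_basis by (simp add: \<phi>_def)
    show "t n * (SUP g\<in>signed_basis. lq_functional (h (n - 1)) g) \<le> lq_functional (h (n - 1)) (\<phi> n)"
      using greedy[of "n - 1"] n by (simp add: \<phi>_def)
    show "nrm X (\<iota> (x 0) \<ominus>\<^bsub>X\<^esub> G n) \<le> (1 + \<eta> n) * best_approx_error X (\<iota> (x 0)) (lin_span X (\<phi> ` {1..n}))"
    proof -
      have "0 \<le> 1 + \<eta> n" using \<eta>0[OF n] by simp
      from mult_left_mono[OF best[OF n] this] near[OF n] show ?thesis unfolding minus by simp
    qed
  qed (use Fh GV minus in auto)
  moreover have "\<not> (\<lambda>n. nrm X (\<iota> (x n))) \<longlonglongrightarrow> 0"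
  proof
    assume "(\<lambda>n. nrm X (\<iota> (x n))) \<longlonglongrightarrow> 0"
    then have "\<forall>\<^sub>F n in sequentially. lqnorm q (x n) < 1" by (intro order_tendstoD(2)[where a=1 and y=0]) auto
    then obtain n where "lqnorm q (x n) < 1" by (auto simp: eventually_sequentially)
    with one[OF x(1) at1(3), of n] show False by simp
  qed
  ultimately have "\<not> awcga_converges X signed_basis t \<delta> \<eta> (\<iota> (x 0))"
    unfolding awcga_converges_def by blast
  moreover have "\<iota> (x 0) \<in> carrier X" using x by simp
  ultimately show ?thesis by blast
qed

end

section \<open>Subsequences and summability\<close>

text \<open>
A diagonal argument: on the \<open>J\<close>-th block the indices with \<open>d n \<le> s n / (J + 1)\<close> are collected, and
the block is long enough for their \<open>s n\<close> to add up to at least 1.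
\<close>

lemma subsequence_of_divergent_sums:
  fixes s d :: "nat \<Rightarrow> real"
  assumes s: "\<And>n. 0 \<le> s n"
    and div: "\<And>\<alpha>. 0 < \<alpha> \<Longrightarrow> \<not> summable (\<lambda>n. if 1 \<le> n \<and> d n \<le> \<alpha> * s n then s n else 0)"
    and d: "\<And>n. 1 \<le> n \<Longrightarrow> 0 \<le> d n"
  shows "\<exists>n. strict_mono n \<and> (\<forall>k. 1 \<le> n k) \<and> filterlim (\<lambda>K. \<Sum>k<K. s (n k)) at_top sequentially
    \<and> nonneg_little_o (\<lambda>k. d (n k)) (\<lambda>k. s (n k))"
proof -
  define u where "u J n = (if 1 \<le> n \<and> d n \<le> 1 / real (J + 1) * s n then s n else 0)" for J n :: nat
  have u0: "0 \<le> u J n" for J n using s by (simp add: u_def)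
  have block: "\<exists>N'>N. 1 \<le> (\<Sum>n\<in>{N..<N'}. u J n)" for J N
  proof (rule ccontr)
    assume neg: "\<not> ?thesis"
    have "(\<Sum>n<K. u J n) \<le> (\<Sum>n<N. u J n) + 1" for K
    proof (cases "N < K")
      case True
      have "(\<Sum>n<K. u J n) = (\<Sum>n<N. u J n) + (\<Sum>n\<in>{N..<K}. u J n)"
        using True by (subst sum.union_disjoint[symmetric]) (auto intro!: sum.cong)
      with neg True show ?thesis by (auto simp: not_le)
    next
      case False
      then have "(\<Sum>n<K. u J n) \<le> (\<Sum>n<N. u J n)" using u0 by (intro sum_mono2) auto
      then show ?thesis by simp
    qed
    then have "summable (u J)" by (intro summableI_nonneg_bounded u0)
    with div[of "1 / real (J + 1)"] show False by (simp add: u_def[abs_def])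
  qed
  obtain N where N: "\<And>J. N J < N (Suc J)" "\<And>J. 1 \<le> (\<Sum>n\<in>{N J..<N (Suc J)}. u J n)"
    using dependent_nat_choice[of "\<lambda>_ _. True" "\<lambda>J N N'. N < N' \<and> 1 \<le> (\<Sum>n\<in>{N..<N'}. u J n)"] block by auto
  have Nmono: "strict_mono N" using N(1) by (simp add: strict_mono_Suc_iff)
  define B where "B = {n. 1 \<le> n \<and> (\<exists>J. N J \<le> n \<and> n < N (Suc J) \<and> d n \<le> 1 / real (J + 1) * s n)}"
  have Bsmall: "d n \<le> 1 / real (J + 1) * s n" if n: "n \<in> B" "N J \<le> n" for n J
  proof -
    from n(1) obtain I where I: "N I \<le> n" "n < N (Suc I)" "d n \<le> 1 / real (I + 1) * s n" by (auto simp: B_def)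
    have "J < Suc I" using n(2) I(2) Nmono by (metis le_less_trans strict_mono_less)
    then have "1 / real (I + 1) * s n \<le> 1 / real (J + 1) * s n"
      using s by (intro mult_right_mono divide_left_mono) auto
    with I(3) show ?thesis by simp
  qed
  have Bsum: "real J \<le> (\<Sum>n\<in>B \<inter> {..<N J}. s n)" for J
  proof (induction J)
    case 0
    show ?case using s by (simp add: sum_nonneg)
  next
    case (Suc J)
    have "(\<Sum>n\<in>{N J..<N (Suc J)}. u J n) = (\<Sum>n\<in>{n\<in>{N J..<N (Suc J)}. 1 \<le> n \<and> d n \<le> 1 / real (J + 1) * s n}. s n)"
      unfolding u_def by (rule sum.inter_filter[symmetric]) simp
    also have "\<dots> \<le> (\<Sum>n\<in>B \<inter> {N J..<N (Suc J)}. s n)"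
      using s by (intro sum_mono2) (auto simp: B_def)
    finally have "1 \<le> (\<Sum>n\<in>B \<inter> {N J..<N (Suc J)}. s n)" using N(2)[of J] by simp
    moreover have split: "B \<inter> {..<N (Suc J)} = (B \<inter> {..<N J}) \<union> (B \<inter> {N J..<N (Suc J)})" using N(1)[of J] by auto
    have "(\<Sum>n\<in>B \<inter> {..<N (Suc J)}. s n) = (\<Sum>n\<in>B \<inter> {..<N J}. s n) + (\<Sum>n\<in>B \<inter> {N J..<N (Suc J)}. s n)"
      unfolding split by (rule sum.union_disjoint) auto
    ultimately show ?case using Suc by simp
  qed
  have "infinite B"
  proof
    assume fin: "finite B"
    obtain J :: nat where J: "(\<Sum>n\<in>B. s n) < real J" using reals_Archimedean2 by blast
    have "(\<Sum>n\<in>B \<inter> {..<N J}. s n) \<le> (\<Sum>n\<in>B. s n)" using fin s by (intro sum_mono2) auto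
    with J Bsum[of J] show False by simp
  qed
  define n where "n = enumerate B"
  have n: "strict_mono n" "\<And>k. n k \<in> B" "range n = B"
    using \<open>infinite B\<close> by (auto simp: n_def strict_mono_enumerate enumerate_in_set range_enumerate)
  have nk: "k \<le> n k" for k using strict_mono_imp_increasing[OF n(1)] .
  have "filterlim (\<lambda>K. \<Sum>k<K. s (n k)) at_top sequentially"
    unfolding filterlim_at_top
  proof
    fix Z :: real
    obtain J :: nat where J: "Z \<le> real J" using real_arch_simple by blast
    have "Z \<le> (\<Sum>k<K. s (n k))" if K: "N J \<le> K" for K
    proof -
      have "B \<inter> {..<N J} \<subseteq> n ` {..<K}"
      proof
        fix a assume a: "a \<in> B \<inter> {..<N J}"
        then obtain k where k: "a = n k" using n(3) by auto
        with a K nk[of k] show "a \<in> n ` {..<K}" by auto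
      qed
      then have "(\<Sum>a\<in>B \<inter> {..<N J}. s a) \<le> (\<Sum>a\<in>n ` {..<K}. s a)" using s by (intro sum_mono2) auto
      also have "\<dots> = (\<Sum>k<K. s (n k))"
        using strict_mono_imp_inj_on[OF n(1)] by (subst sum.reindex) (auto intro: inj_on_subset)
      finally show ?thesis using Bsum[of J] J by simp
    qed
    then show "\<forall>\<^sub>F K in sequentially. Z \<le> (\<Sum>k<K. s (n k))" by (auto simp: eventually_sequentially)
  qed
  moreover have "nonneg_little_o (\<lambda>k. d (n k)) (\<lambda>k. s (n k))"
    unfolding nonneg_little_o_def
  proof (intro exI conjI allI)
    have n1: "1 \<le> n k" for k using n(2)[of k] by (auto simp: B_def)
    have dn: "d (n k) \<le> 1 / real (J + 1) * s (n k)" if "N J \<le> n k" for k J using Bsmall[OF n(2) that] .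
    show "(\<lambda>k. d (n k) / s (n k)) \<longlonglongrightarrow> 0"
    proof (rule LIMSEQ_I)
      fix e :: real assume "0 < e"
      then obtain J where J: "1 / real (Suc J) < e" using nat_approx_posE by metis
      have "norm (d (n k) / s (n k) - 0) < e" if "N J \<le> k" for k
      proof -
        have "d (n k) \<le> 1 / real (Suc J) * s (n k)" using dn[of J k] that nk[of k] by simp
        then have "d (n k) / s (n k) \<le> 1 / real (Suc J)"
          using s[of "n k"] by (cases "s (n k) = 0") (auto simp: divide_le_eq order_less_le)
        moreover have "0 \<le> d (n k) / s (n k)" using s[of "n k"] d[OF n1] by simp
        ultimately show ?thesis using J by simp
      qed
      then show "\<exists>k0. \<forall>k\<ge>k0. norm (d (n k) / s (n k) - 0) < e" by blast
    qed
    \<comment> \<open>The quotient is 0 when \<open>s (n k) = 0\<close>, but then membership in \<open>B\<close> gives \<open>d (n k) \<le> 0\<close>.\<close>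
    show "d (n k) \<le> d (n k) / s (n k) * s (n k)" for k
    proof (cases "s (n k) = 0")
      case True
      from n(2)[of k] obtain J where "d (n k) \<le> 1 / real (J + 1) * s (n k)" by (auto simp: B_def)
      with True show ?thesis by simp
    qed simp
  qed
  moreover have "1 \<le> n k" for k using n(2)[of k] by (auto simp: B_def)
  ultimately show ?thesis using n(1) by blast
qed

theorem theorem1:
  fixes q p :: real and t \<delta> \<eta> :: "nat \<Rightarrow> real"
  assumes "\<exists>\<iota> :: (nat \<Rightarrow> real) \<Rightarrow> 'a. inj \<iota>"
    and "1 < q" and "q \<le> 2" and "p = q / (q - 1)"
    and "weakness_seq t" and "perturbation_seq \<delta>"
    and "error_seq \<eta>" and "bounded (\<eta> ` {1..})"
  shows "(\<forall>X :: 'a normed_struct. X \<in> power_smooth q \<longrightarrow>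
            (\<forall>D f. dictionary X D \<longrightarrow> f \<in> carrier X \<longrightarrow> awcga_converges X D t \<delta> \<eta> f)) \<longleftrightarrow>
         (\<exists>n :: nat \<Rightarrow> nat.
            strict_mono n \<and> (\<forall>k. 1 \<le> n k) \<and>
            filterlim (\<lambda>K. \<Sum>k<K. t (n k + 1) powr p) at_top sequentially \<and>
            nonneg_little_o (\<lambda>k. \<delta> (n k)) (\<lambda>k. t (n k + 1) powr p) \<and>
            nonneg_little_o (\<lambda>k. \<eta> (n k)) (\<lambda>k. t (n k + 1) powr p))"
    (is "?conv \<longleftrightarrow> ?sub")
proof
  assume ?sub
  then show ?conv using assms(2,4-) by (auto intro: awcga_converges_along_subsequence)
next
  assume conv: ?conv
  show ?sub
  proof (rule ccontr)
    assume nsub: "\<not> ?sub"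
    define s where "s n = t (n + 1) powr p" for n
    define d where "d n = \<delta> n + \<eta> n" for n
    have \<delta>0: "0 \<le> \<delta> n" for n using assms(6) by (simp add: perturbation_seq_def)
    have \<eta>0: "0 \<le> \<eta> n" if "1 \<le> n" for n using assms(7) that by (simp add: error_seq_def)
    have "\<exists>\<alpha>>0. summable (\<lambda>n. if 1 \<le> n \<and> d n \<le> \<alpha> * s n then s n else 0)"
    proof (rule ccontr)
      assume "\<not> ?thesis"
      then have "\<not> summable (\<lambda>n. if 1 \<le> n \<and> d n \<le> \<alpha> * s n then s n else 0)" if "0 < \<alpha>" for \<alpha> using that by blast
      from subsequence_of_divergent_sums[OF _ this] \<delta>0 \<eta>0 obtain n where n: "strict_mono n" "\<And>k. 1 \<le> n k"
        "filterlim (\<lambda>K. \<Sum>k<K. s (n k)) at_top sequentially" "nonneg_little_o (\<lambda>k. d (n k)) (\<lambda>k. s (n k))"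
        by (auto simp: s_def d_def)
      from n(4) obtain \<epsilon> where \<epsilon>: "\<epsilon> \<longlonglongrightarrow> 0" "\<And>k. d (n k) \<le> \<epsilon> k * s (n k)" by (auto simp: nonneg_little_o_def)
      have "\<delta> (n k) \<le> \<epsilon> k * s (n k)" "\<eta> (n k) \<le> \<epsilon> k * s (n k)" for k
        using \<epsilon>(2)[of k] \<delta>0[of "n k"] \<eta>0[OF n(2)[of k]] by (auto simp: d_def)
      with \<epsilon>(1) have "nonneg_little_o (\<lambda>k. \<delta> (n k)) (\<lambda>k. s (n k))" "nonneg_little_o (\<lambda>k. \<eta> (n k)) (\<lambda>k. s (n k))"
        by (auto simp: nonneg_little_o_def)
      with n nsub show False by (auto simp: s_def)
    qed
    then obtain \<alpha> where \<alpha>: "0 < \<alpha>" and sum: "summable (\<lambda>n. if 1 \<le> n \<and> d n \<le> \<alpha> * s n then s n else 0)" by auto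
    define L where "L = {n. 1 \<le> n \<and> d n \<le> \<alpha> * s n}"
    \<comment> \<open>For \<open>n \<notin> L\<close> one of \<open>\<delta> n\<close>, \<open>\<eta> n\<close> exceeds \<open>\<alpha> * s n / 2\<close>, hence \<open>s n / m\<close>.\<close>
    obtain m :: nat where m0: "2 / \<alpha> < m" using reals_Archimedean2 by blast
    have m1: "1 \<le> m" using m0 \<alpha> by (cases m) (auto simp: field_simps)
    from assms(1) obtain \<iota> :: "(nat \<Rightarrow> real) \<Rightarrow> 'a" where "inj \<iota>" by blast
    then interpret embedded_lq \<iota> q using assms(2,3) by unfold_locales
    have "s n \<le> m * \<delta> n \<or> s n \<le> m * \<eta> n" if "1 \<le> n" "n \<notin> L" for n
    proof (rule ccontr)
      assume "\<not> ?thesis"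
      then have "m * d n < 2 * s n" by (simp add: d_def distrib_left)
      moreover have "m * (\<alpha> * s n) \<le> m * d n" using that by (intro mult_left_mono) (auto simp: L_def)
      moreover have "2 * s n \<le> (m * \<alpha>) * s n"
        using m0 \<alpha> by (intro mult_right_mono) (auto simp: field_simps s_def)
      ultimately show False by (simp add: mult_ac)
    qed
    then have "\<And>n. 1 \<le> n \<Longrightarrow> n \<notin> L \<Longrightarrow> t (n + 1) powr (q / (q - 1)) \<le> m * \<delta> n \<or> t (n + 1) powr (q / (q - 1)) \<le> m * \<eta> n"
      by (simp add: s_def assms(4))
    moreover have "summable (\<lambda>n. if n \<in> L then t (n + 1) powr (q / (q - 1)) else 0)"
      using sum unfolding L_def s_def assms(4) mem_Collect_eq .
    moreover have "0 \<notin> L" by (simp add: L_def)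
    ultimately have "\<exists>f\<in>carrier X. \<not> awcga_converges X signed_basis t \<delta> \<eta> f"
      using m1 by (intro divergent_realization[OF assms(5-7)])
    with conv power_smooth_lq dictionary_signed_basis show False by blast
  qed
qed

end
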